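(* For every formal power series $f(x)$ in one variable, the content series satisfies $$\Phi^{f(x)}(y,z,\mathbf p)=\sum_{n\ge 0}\frac{z^n}{n!}\sum_{\alpha\vdash n}p_\alpha\,|\mathcal C_\alpha|\,[\mathcal C_\alpha]\prod_{i=1}^n f(yJ_i).$$
   Context: Coefficients are in a field of characteristic $0$. $\mathbf p=(p_1,p_2,\ldots)$ are the power sum symmetric functions and $p_\alpha=p_{\alpha_1}p_{\alpha_2}\cdots$ for a partition $\alpha$. $\mathcal C_\alpha$ denotes both the conjugacy class of permutations of cycle type $\alpha$ in the symmetric group $\mathcal S_n$ and the formal sum of its elements in the group algebra of $\mathcal S_n$; $|\mathcal C_\alpha|$ is the size of the class. The Schur function is $s_\lambda(\mathbf p)=\sum_{\alpha\vdash n}\frac{|\mathcal C_\alpha|}{n!}\chi^\lambda_\alpha p_\alpha$ for $\lambda\vdash n$, where $\chi^\lambda_\alpha$ is the value of the irreducible character $\chi^\lambda$ of $\mathcal S_n$ on $\mathcal C_\alpha$. The content of a cell $\Box$ in row $i$, column $j$ of the diagram of a partition is $c(\Box)=j-i$. The content series is $$\Phi^{f(x)}(y,z,\mathbf p)=\sum_{n\ge 0}\frac{z^n}{n!}\sum_{\lambda\vdash n}\chi^\lambda_{(1^n)}\,s_\lambda(\mathbf p)\prod_{\Box\in\lambda}f(y\,c(\Box)),$$ where the product is over all cells $\Box$ of the diagram of $\lambda$. For $1\le i\le n$, $J_i=(1\ i)+(2\ i)+\cdots+(i-1\ i)$ is the Jucys–Murphy element in the group algebra of $\mathcal S_n$ (so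 $J_1=0$). Any symmetric function of $J_1,\ldots,J_n$ lies in the center of the group algebra, and $[\mathcal C_\alpha]B$ denotes the coefficient of the class sum $\mathcal C_\alpha$ in the expansion of the central element $B$ in the basis of class sums (coefficientwise in $y$). *)

theory Defs
  imports
    "HOL-Combinatorics.Perm"
    "HOL-Combinatorics.Permutations"
    "HOL-Computational_Algebra.Formal_Power_Series"
    "HOL-Library.Poly_Mapping"
begin

unbundle permutation_syntax

section \<open>Partitions\<close>

definition partitions_of :: "nat \<Rightarrow> nat list set" where
  "partitions_of n = {\<mu>. sorted_wrt (\<ge>) \<mu> \<and> 0 \<notin> set \<mu> \<and> sum_list \<mu> = n}"

text \<open>Cells \<open>(i, j)\<close> (row, column) are counted from 0, which does not affect the content \<open>j - i\<close>.\<close>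

definition cells :: "nat list \<Rightarrow> (nat \<times> nat) set" where
  "cells \<mu> = {(i, j). i < length \<mu> \<and> j < \<mu> ! i}"

definition content :: "nat \<times> nat \<Rightarrow> int" where
  "content c = int (snd c) - int (fst c)"

section \<open>The symmetric groups and their group algebras\<close>

text \<open>
  The symmetric group on \<open>{1..n}\<close> consists of the finitary permutations of the natural numbers
  that move points of \<open>{1..n}\<close> only.
\<close>

definition Sym :: "nat \<Rightarrow> nat perm set" where
  "Sym n = {g. affected g \<subseteq> {1..n}}"

text \<open>Fixed points in \<open>{1..n}\<close> contribute parts equal to 1.\<close>

definition cycle_type :: "nat \<Rightarrow> nat perm \<Rightarrow> nat multiset" where
  "cycle_type n g = image_mset card (mset_set (orbit g ` {1..n}))"

definition conj_class :: "nat \<Rightarrow> nat list \<Rightarrow> nat perm set" where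
  "conj_class n \<alpha> = {g \<in> Sym n. cycle_type n g = mset \<alpha>}"

text \<open>
  The convolution product on \<open>'g \<Rightarrow>\<^sub>0 'a\<close> is available for a (not necessarily commutative)
  monoid \<open>'g\<close> that is written additively. Composition of permutations therefore also gets an
  additive notation, so that the ring \<open>nat perm \<Rightarrow>\<^sub>0 'a\<close> is the group algebra of the group of
  all finitary permutations.
\<close>

instantiation perm :: (type) monoid_add
begin

definition zero_perm :: "'a perm" where
  "zero_perm = 1"

definition plus_perm :: "'a perm \<Rightarrow> 'a perm \<Rightarrow> 'a perm" where
  "plus_perm g h = g * h"

instance
  by standard (simp_all add: zero_perm_def plus_perm_def mult.assoc)

end

type_synonym 'a group_algebra = "nat perm \<Rightarrow>\<^sub>0 'a"

definition of_perm :: "nat perm \<Rightarrow> 'a::field group_algebra" where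
  "of_perm g = Poly_Mapping.single g 1"

definition ga_const :: "'a \<Rightarrow> 'a::field group_algebra" where
  "ga_const a = Poly_Mapping.single 0 a"

definition ga_scale :: "'a \<Rightarrow> 'a group_algebra \<Rightarrow> 'a::field group_algebra" where
  "ga_scale a x = ga_const a * x"

interpretation ga: vector_space "ga_scale :: 'a::field \<Rightarrow> 'a group_algebra \<Rightarrow> 'a group_algebra"
  by standard
    (simp_all add: ga_scale_def ga_const_def distrib_left distrib_right single_add mult_single
      flip: mult.assoc)

text \<open>The group algebra of the symmetric group on \<open>{1..n}\<close>, as a subalgebra.\<close>

definition Sym_algebra :: "nat \<Rightarrow> 'a::field group_algebra set" where
  "Sym_algebra n = {x. Poly_Mapping.keys x \<subseteq> Sym n}"

definition class_sum :: "nat \<Rightarrow> nat list \<Rightarrow> 'a::field group_algebra" where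
  "class_sum n \<alpha> = (\<Sum>g\<in>conj_class n \<alpha>. of_perm g)"

text \<open>
  The coefficient of a class sum in the expansion of a central element \<open>b\<close> in the basis of class
  sums. (The library function \<open>representation\<close> is 0 outside of the span of the given basis.)
\<close>

definition class_coeff :: "nat \<Rightarrow> nat list \<Rightarrow> 'a::field group_algebra \<Rightarrow> 'a" where
  "class_coeff n \<alpha> b = ga.representation (class_sum n ` partitions_of n) b (class_sum n \<alpha>)"

definition jucys_murphy :: "nat \<Rightarrow> 'a::field group_algebra" where
  "jucys_murphy i = (\<Sum>j\<in>{1..<i}. of_perm \<langle>j \<leftrightarrow> i\<rangle>)"

section \<open>Irreducible characters\<close>

text \<open>
  The irreducible module of the symmetric group indexed by \<open>\<mu>\<close> is the left ideal of the group
  algebra generated by the Young symmetrizer of the standard tableau of shape \<open>\<mu>\<close> in which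
  \<open>1, 2, 3, \<dots>\<close> are entered row by row. In characteristic 0 these modules are absolutely
  irreducible, pairwise non-isomorphic, and exhaust the irreducible modules. The one-row shape
  gives the trivial module, the one-column shape the sign module.
\<close>

definition tableau :: "nat list \<Rightarrow> nat \<times> nat \<Rightarrow> nat" where
  "tableau \<mu> c = sum_list (take (fst c) \<mu>) + snd c + 1"

definition row_group :: "nat list \<Rightarrow> nat perm set" where
  "row_group \<mu> = {g \<in> Sym (sum_list \<mu>). \<forall>c\<in>cells \<mu>. \<exists>d\<in>cells \<mu>.
     fst d = fst c \<and> g \<langle>$\<rangle> (tableau \<mu> c) = tableau \<mu> d}"

definition column_group :: "nat list \<Rightarrow> nat perm set" where
  "column_group \<mu> = {g \<in> Sym (sum_list \<mu>). \<forall>c\<in>cells \<mu>. \<exists>d\<in>cells \<mu>.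
     snd d = snd c \<and> g \<langle>$\<rangle> (tableau \<mu> c) = tableau \<mu> d}"

definition young_symmetrizer :: "nat list \<Rightarrow> 'a::field group_algebra" where
  "young_symmetrizer \<mu> =
     (\<Sum>g\<in>row_group \<mu>. of_perm g) *
     (\<Sum>g\<in>column_group \<mu>. ga_scale (of_int (sign (apply g))) (of_perm g))"

definition irreducible_module :: "nat list \<Rightarrow> 'a::field group_algebra set" where
  "irreducible_module \<mu> = (\<lambda>x. x * young_symmetrizer \<mu>) ` Sym_algebra (sum_list \<mu>)"

text \<open>The trace of a linear operator \<open>T\<close> on a finite-dimensional invariant subspace \<open>W\<close>.\<close>

definition trace_on ::
    "'a::field group_algebra set \<Rightarrow> ('a group_algebra \<Rightarrow> 'a group_algebra) \<Rightarrow> 'a" where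
  "trace_on W T =
     (let B = (SOME B. ga.independent B \<and> ga.span B = W)
      in \<Sum>b\<in>B. ga.representation B (T b) b)"

definition irreducible_character :: "nat list \<Rightarrow> nat perm \<Rightarrow> 'a::field" where
  "irreducible_character \<mu> g = trace_on (irreducible_module \<mu>) (\<lambda>x. of_perm g * x)"

text \<open>The common value of the character on a conjugacy class, read off at a representative.\<close>

definition character_value :: "nat list \<Rightarrow> nat list \<Rightarrow> 'a::field" where
  "character_value \<mu> \<alpha> =
     irreducible_character \<mu> (SOME g. g \<in> conj_class (sum_list \<mu>) \<alpha>)"

section \<open>Power sums and Schur functions\<close>

text \<open>
  Formal power series in countably many commuting variables \<open>x\<^sub>0, x\<^sub>1, \<dots>\<close>, given by the
  coefficients of the monomials (exponent vectors of finite support). The ring of symmetric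
  functions is a subring of this ring.
\<close>

typedef 'a mps = "UNIV :: ((nat \<Rightarrow>\<^sub>0 nat) \<Rightarrow> 'a) set"
  morphisms mps_coeff Abs_mps ..

setup_lifting type_definition_mps

lemma mps_eqI: "(\<And>m. mps_coeff f m = mps_coeff g m) \<Longrightarrow> f = g"
  by transfer auto

lemma finite_monomial_factors:
  "finite {(a, b). a + b = (m :: nat \<Rightarrow>\<^sub>0 nat)}"
proof -
  let ?le = "{a. \<forall>k. Poly_Mapping.lookup a k \<le> Poly_Mapping.lookup m k}"
  let ?N = "\<Sum>k\<in>Poly_Mapping.keys m. Poly_Mapping.lookup m k"
  have "Poly_Mapping.lookup ` ?le \<subseteq>
      {h. \<forall>k. (k \<in> Poly_Mapping.keys m \<longrightarrow> h k \<in> {..?N}) \<and> (k \<notin> Poly_Mapping.keys m \<longrightarrow> h k = 0)}"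
    by (auto intro: order.trans[OF _ member_le_sum] simp: in_keys_iff)
       (metis le_zero_eq)
  moreover have "finite \<dots>"
    by (rule finite_set_of_finite_funs) auto
  ultimately have "finite (Poly_Mapping.lookup ` ?le)"
    by (rule finite_subset)
  then have "finite ?le"
    by (rule finite_imageD) (simp add: inj_on_def)
  moreover have "{(a, b). a + b = m} \<subseteq> ?le \<times> ?le"
    by (auto simp: lookup_add)
  ultimately show ?thesis
    by (meson finite_SigmaI finite_subset)
qed

instantiation mps :: (comm_ring_1) comm_ring_1
begin

lift_definition zero_mps :: "'a mps" is "\<lambda>_. 0" .

lift_definition one_mps :: "'a mps" is "\<lambda>m. if m = 0 then 1 else 0" .

lift_definition plus_mps :: "'a mps \<Rightarrow> 'a mps \<Rightarrow> 'a mps" is "\<lambda>f g m. f m + g m" .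

lift_definition minus_mps :: "'a mps \<Rightarrow> 'a mps \<Rightarrow> 'a mps" is "\<lambda>f g m. f m - g m" .

lift_definition uminus_mps :: "'a mps \<Rightarrow> 'a mps" is "\<lambda>f m. - f m" .

lift_definition times_mps :: "'a mps \<Rightarrow> 'a mps \<Rightarrow> 'a mps" is
  "\<lambda>f g m. \<Sum>(a, b) | a + b = m. f a * g b" .

instance
proof
  fix f g h :: "'a mps"
  show "f * g * h = f * (g * h)"
  proof (transfer, rule ext)
    fix f g h :: "(nat \<Rightarrow>\<^sub>0 nat) \<Rightarrow> 'a" and m
    have "(\<Sum>(d, c) | d + c = m. (\<Sum>(a, b) | a + b = d. f a * g b) * h c) =
        (\<Sum>((d, c), (a, b)) \<in> Sigma {(d, c). d + c = m} (\<lambda>(d, c). {(a, b). a + b = d}).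
          f a * g b * h c)"
      by (subst sum.Sigma[symmetric])
         (auto simp: finite_monomial_factors sum_distrib_right case_prod_beta)
    also have "\<dots> =
        (\<Sum>((a, d), (b, c)) \<in> Sigma {(a, d). a + d = m} (\<lambda>(a, d). {(b, c). b + c = d}).
          f a * (g b * h c))"
      by (rule sum.reindex_bij_witness[of _ "\<lambda>((a, d), (b, c)). ((a + b, c), (a, b))"
            "\<lambda>((d, c), (a, b)). ((a, b + c), (b, c))"]) (auto simp: ac_simps)
    also have "\<dots> = (\<Sum>(a, d) | a + d = m. f a * (\<Sum>(b, c) | b + c = d. g b * h c))"
      by (subst sum.Sigma[symmetric])
         (auto simp: finite_monomial_factors sum_distrib_left case_prod_beta)
    finally show "(\<Sum>(d, c) | d + c = m. (\<Sum>(a, b) | a + b = d. f a * g b) * h c) =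
        (\<Sum>(a, d) | a + d = m. f a * (\<Sum>(b, c) | b + c = d. g b * h c))" .
  qed
  show "f * g = g * f"
    by (transfer, rule ext,
        rule sum.reindex_bij_witness[of _ "\<lambda>(a, b). (b, a)" "\<lambda>(a, b). (b, a)"])
       (auto simp: ac_simps)
  show "1 * f = f"
  proof (transfer, rule ext)
    fix f :: "(nat \<Rightarrow>\<^sub>0 nat) \<Rightarrow> 'a" and m
    have "(\<Sum>(a, b) | a + b = m. (if a = 0 then 1 else 0) * f b) =
        (\<Sum>(a, b) \<in> {(0 :: nat \<Rightarrow>\<^sub>0 nat, m)}. (if a = 0 then 1 else 0) * f b)"
      by (rule sum.mono_neutral_right) (auto simp: finite_monomial_factors split: if_splits)
    then show "(\<Sum>(a, b) | a + b = m. (if a = 0 then 1 else 0) * f b) = f m"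
      by simp
  qed
  show "(f + g) * h = f * h + g * h"
    by transfer (simp add: fun_eq_iff distrib_right sum.distrib case_prod_beta)
  show "(0 :: 'a mps) \<noteq> 1"
    by transfer (auto simp: fun_eq_iff)
qed (transfer; simp add: fun_eq_iff add.assoc add.commute)+

end

lift_definition mps_const :: "'a::comm_ring_1 \<Rightarrow> 'a mps" is
  "\<lambda>c m. if m = 0 then c else 0" .

text \<open>\<open>power_sum k\<close> is \<open>\<Sum>\<^sub>i x\<^sub>i\<^sup>k\<close> for \<open>k \<ge> 1\<close>.\<close>

lift_definition power_sum :: "nat \<Rightarrow> 'a::comm_ring_1 mps" is
  "\<lambda>k m. if \<exists>i. m = Poly_Mapping.single i k then 1 else 0" .

definition power_sums :: "nat list \<Rightarrow> 'a::comm_ring_1 mps" where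
  "power_sums \<alpha> = prod_list (map power_sum \<alpha>)"

definition schur :: "nat list \<Rightarrow> 'a::field_char_0 mps" where
  "schur \<mu> = (let n = sum_list \<mu> in
     \<Sum>\<alpha>\<in>partitions_of n.
       mps_const (of_nat (card (conj_class n \<alpha>)) / fact n * character_value \<mu> \<alpha>) * power_sums \<alpha>)"

section \<open>The content series\<close>

text \<open>
  The content series lives in \<open>'a mps fps fps\<close>: the outer series variable is \<open>z\<close>, the inner one
  is \<open>y\<close>. The functions \<open>fps_lift\<close> and \<open>ga_fps_lift\<close> embed series over the ground field into
  series over the symmetric functions and over the group algebra.
\<close>

definition fps_lift :: "'a::comm_ring_1 fps \<Rightarrow> 'a mps fps" where
  "fps_lift g = Abs_fps (\<lambda>k. mps_const (fps_nth g k))"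

definition ga_fps_lift :: "'a::field fps \<Rightarrow> 'a group_algebra fps" where
  "ga_fps_lift g = Abs_fps (\<lambda>k. ga_const (fps_nth g k))"

definition content_series :: "'a::field_char_0 fps \<Rightarrow> 'a mps fps fps" where
  "content_series f = Abs_fps (\<lambda>n. fps_const (mps_const (1 / fact n)) *
     (\<Sum>\<mu>\<in>partitions_of n.
        fps_const (mps_const (character_value \<mu> (replicate n 1)) * schur \<mu>) *
        fps_lift (\<Prod>c\<in>cells \<mu>. f oo (fps_const (of_int (content c)) * fps_X))))"

text \<open>
  The product of the series \<open>f (y J\<^sub>i)\<close> for \<open>i = 1, \<dots>, n\<close>, in this order (the Jucys--Murphy
  elements commute with each other), as a series in \<open>y\<close> over the group algebra.
\<close>

definition jucys_murphy_product :: "'a::field fps \<Rightarrow> nat \<Rightarrow> 'a group_algebra fps" where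
  "jucys_murphy_product f n =
     prod_list (map (\<lambda>i. ga_fps_lift f oo (fps_const (jucys_murphy i) * fps_X)) [1..<Suc n])"

definition fps_class_coeff :: "nat \<Rightarrow> nat list \<Rightarrow> 'a::field group_algebra fps \<Rightarrow> 'a fps" where
  "fps_class_coeff n \<alpha> b = Abs_fps (\<lambda>k. class_coeff n \<alpha> (fps_nth b k))"

end

theory Submission
  imports Defs
begin

text \<open>
  Both sides are compared coefficient by coefficient in \<open>z\<close>, \<open>y\<close> and the power sums. What remains
  is Frobenius' formula for the coefficient of a class sum in a central element \<open>b\<close> that acts on
  the irreducible module of each \<open>\<mu>\<close> by a scalar \<open>\<omega>\<^sub>\<mu>\<close>:
  \<open>[C\<^sub>\<alpha>] b = 1 / n! * (\<Sum>\<mu>. \<chi>\<^sup>\<mu>(1) * \<chi>\<^sup>\<mu>(\<alpha>) * \<omega>\<^sub>\<mu>)\<close>.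
  It is applied to the coefficients \<open>b\<close> of powers of \<open>y\<close> in the product of the \<open>f(y J\<^sub>i)\<close>, for
  which \<open>\<omega>\<^sub>\<mu>\<close> has to be the same coefficient of the product of the series \<open>f(y c)\<close> over the
  contents \<open>c\<close> of \<open>\<mu>\<close>.

  For Frobenius' formula, let \<open>e\<close> be the Young symmetrizer of \<open>\<mu>\<close>. Then \<open>e x e\<close> is a multiple of
  \<open>e\<close> for all \<open>x\<close>, in particular \<open>e\<^sup>2 = h e\<close>, and \<open>e x e' = 0\<close> for the Young symmetrizer \<open>e'\<close> of
  another partition. Both follow from the classical observation that two tableaux either have two
  entries in a common row of one and a common column of the other, or compare in the dominance order
  (lemmas \<open>young_symmetrizer_sandwich\<close> and \<open>young_symmetrizer_orthogonal\<close>). The sum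
  \<open>\<epsilon>\<^sub>\<mu>\<close> of all conjugates \<open>k e k\<^sup>-\<^sup>1\<close> is central. Computing the trace of
  \<open>x \<mapsto> g x e\<close> once on the module and once on the whole group algebra gives
  \<open>h \<chi>\<^sup>\<mu>(g) = [g\<^sup>-\<^sup>1] \<epsilon>\<^sub>\<mu>\<close> (lemma \<open>young_norm_mult_character\<close>); for \<open>g = 1\<close> this says
  \<open>h \<chi>\<^sup>\<mu>(1) = n!\<close>, so \<open>h\<close> is not 0. Moreover \<open>\<epsilon>\<^sub>\<mu> e = h\<^sup>2 e\<close> and \<open>\<epsilon>\<^sub>\<mu> e' = 0\<close>. Hence the \<open>\<epsilon>\<^sub>\<mu>\<close> are
  independent, and since there are as many of them as class sums, they form a basis of the center, in
  which \<open>b\<close> has the coordinates \<open>\<omega>\<^sub>\<mu> / h\<^sup>2\<close> (lemma \<open>central_expansion\<close>).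

  Because the tableau is filled row by row, \<open>e\<close> itself is a common eigenvector of the Jucys--Murphy
  elements: the transpositions of \<open>i\<close> with the earlier entries of its row fix \<open>e\<close>, and those with the
  entries of any higher row sum up to \<open>-1\<close> on \<open>e\<close>, so that \<open>J\<^sub>i e = (column - row) e\<close> (lemma
  \<open>jucys_murphy_mult_young_symmetrizer\<close>). The product of the \<open>f(y J\<^sub>i)\<close> is central because it commutes
  with the symmetric group on one letter less and, by the relations between \<open>J\<^sub>n\<close>, \<open>J\<^sub>n\<^sub>+\<^sub>1\<close> and the
  transposition \<open>(n n+1)\<close>, with that transposition (lemma \<open>jucys_murphy_product_commutes\<close>).
\<close>

section \<open>The group algebra\<close>

abbreviation ga_coeff :: "'a::zero group_algebra \<Rightarrow> nat perm \<Rightarrow> 'a" where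
  "ga_coeff \<equiv> Poly_Mapping.lookup"

lemma ga_coeff_of_perm: "ga_coeff (of_perm g) k = (if g = k then 1 else 0)"
  by (simp add: of_perm_def lookup_single when_def)

lemma of_perm_mult: "of_perm (g * h) = of_perm g * of_perm h"
  by (simp add: of_perm_def mult_single plus_perm_def)

lemma of_perm_one [simp]: "of_perm 1 = 1"
  by (simp add: of_perm_def flip: zero_perm_def)

lemma ga_coeff_of_perm_mult: "ga_coeff (of_perm g * x) k = ga_coeff x (inverse g * k)"
proof -
  have *: "k = g + q \<longleftrightarrow> q = inverse g * k" for q
    by (auto simp: plus_perm_def mult.assoc[symmetric])
  show ?thesis
    by (simp add: lookup_mult of_perm_def lookup_single when_mult *)
qed

lemma ga_coeff_mult_of_perm: "ga_coeff (x * of_perm g) k = ga_coeff x (k * inverse g)"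
proof -
  have *: "k = l + g \<longleftrightarrow> l = k * inverse g" for l
    by (auto simp: plus_perm_def mult.assoc)
  have "(\<Sum>q. (1 :: 'a) when g = q when k = l + q) = (\<Sum>q. (1 when k = l + g) when q = g)" for l
    by (rule Sum_any.cong) (auto simp: when_def)
  then have "(\<Sum>q. (1 :: 'a) when g = q when k = l + q) = (1 when l = k * inverse g)" for l
    by (simp add: *)
  then show ?thesis
    by (simp add: lookup_mult of_perm_def lookup_single mult_when)
qed

lemma ga_coeff_scale [simp]: "ga_coeff (ga_scale a x) g = a * ga_coeff x g"
proof -
  have "(\<Sum>l. (a when 0 = l) * (\<Sum>q. ga_coeff x q when g = l + q)) = a * ga_coeff x g"
    by (simp add: when_mult)
  then show ?thesis
    by (simp add: ga_scale_def ga_const_def lookup_mult lookup_single)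
qed

lemma ga_expand:
  assumes "Poly_Mapping.keys x \<subseteq> S" "finite S"
  shows "x = (\<Sum>g\<in>S. ga_scale (ga_coeff x g) (of_perm g))"
proof (rule poly_mapping_eqI)
  fix k
  have "(\<Sum>g\<in>S. ga_coeff x g * (if g = k then 1 else 0)) = (if k \<in> S then ga_coeff x k else 0)"
    using assms(2) by (simp add: if_distrib[of "\<lambda>y. _ * y"] cong: if_cong)
  also have "\<dots> = ga_coeff x k"
    using assms(1) by (auto simp: in_keys_iff)
  finally show "ga_coeff x k = ga_coeff (\<Sum>g\<in>S. ga_scale (ga_coeff x g) (of_perm g)) k"
    by (simp add: lookup_sum ga_coeff_of_perm)
qed

lemma ga_scale_mult_left: "ga_scale a x * y = ga_scale a (x * y)"
  by (simp add: ga_scale_def mult.assoc)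

lemma ga_const_commute: "ga_const a * x = x * ga_const a"
proof -
  have "of_perm g * ga_const a = ga_const a * of_perm g" for g
    by (simp add: of_perm_def ga_const_def mult_single)
  then have "ga_scale b (of_perm g) * ga_const a = ga_const a * ga_scale b (of_perm g)" for b g
    by (simp add: ga_scale_def ga_const_def mult_single of_perm_def mult.commute)
  then show ?thesis
    by (subst (1 2) ga_expand[OF order_refl finite_keys])
       (simp add: sum_distrib_left sum_distrib_right)
qed

lemma ga_scale_mult_right: "x * ga_scale a y = ga_scale a (x * y)"
  unfolding ga_scale_def by (metis ga_const_commute mult.assoc)

lemma ga_const_simps:
  "ga_const 0 = 0" "ga_const 1 = 1" "ga_const (a + b) = ga_const a + ga_const b"
  "ga_const (a * b) = ga_const a * ga_const b"
  by (simp_all add: ga_const_def single_add mult_single)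

lemma ga_scale_of_nat: "ga_scale (of_nat k) x = of_nat k * x"
  by (simp add: ga_scale_def ga_const_def)

lemma ga_coeff_mult:
  fixes x y :: "'a::field group_algebra"
  assumes "Poly_Mapping.keys x \<subseteq> S" "finite S"
  shows "ga_coeff (x * y) k = (\<Sum>g\<in>S. ga_coeff x g * ga_coeff y (inverse g * k))"
  by (subst ga_expand[OF assms])
     (simp add: sum_distrib_right lookup_sum ga_scale_mult_left ga_coeff_of_perm_mult)

text \<open>
  The coefficient of the identity is a trace form, since \<open>g h = 1\<close> if and only if \<open>h g = 1\<close>. This
  makes scalars such as the eigenvalue in \<open>central_symmetrizer_mult_same\<close> computable.
\<close>

lemma ga_coeff_one_commute:
  fixes x y :: "'a::field group_algebra"
  shows "ga_coeff (x * y) 1 = ga_coeff (y * x) 1"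
proof -
  define K where "K = Poly_Mapping.keys x \<union> Poly_Mapping.keys y"
  define S where "S = K \<union> inverse ` K"
  have S: "finite S" "Poly_Mapping.keys x \<subseteq> S" "Poly_Mapping.keys y \<subseteq> S"
    by (auto simp: S_def K_def)
  have "ga_coeff (x * y) 1 = (\<Sum>g\<in>S. ga_coeff x g * ga_coeff y (inverse g))"
    by (simp add: ga_coeff_mult[OF S(2,1)])
  also have "\<dots> = (\<Sum>g\<in>S. ga_coeff y g * ga_coeff x (inverse g))"
    by (rule sum.reindex_bij_witness[of _ inverse inverse]) (auto simp: S_def mult.commute)
  also have "\<dots> = ga_coeff (y * x) 1"
    by (simp add: ga_coeff_mult[OF S(3,1)])
  finally show ?thesis .
qed


section \<open>The symmetric groups\<close>

lemma Sym_one [simp]: "1 \<in> Sym n"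
  by (simp add: Sym_def)

lemma Sym_mult [intro]: "g \<in> Sym n \<Longrightarrow> h \<in> Sym n \<Longrightarrow> g * h \<in> Sym n"
  using affected_times[of g h] unfolding Sym_def by blast

lemma Sym_inverse [intro]: "g \<in> Sym n \<Longrightarrow> inverse g \<in> Sym n"
  by (simp add: Sym_def)

lemma Sym_inverse_iff [simp]: "inverse g \<in> Sym n \<longleftrightarrow> g \<in> Sym n"
  by (simp add: Sym_def)

lemma Sym_swap: "i \<in> {1..n} \<Longrightarrow> j \<in> {1..n} \<Longrightarrow> \<langle>i \<leftrightarrow> j\<rangle> \<in> Sym n"
  by (cases "i = j") (auto simp: Sym_def affected_swap)

lemma apply_inverse_cancel [simp]:
  "inverse g \<langle>$\<rangle> (g \<langle>$\<rangle> m) = m" "g \<langle>$\<rangle> (inverse g \<langle>$\<rangle> m) = m"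
  by (simp_all add: apply_sequence)

lemma apply_mult [simp]: "(g * h) \<langle>$\<rangle> m = g \<langle>$\<rangle> (h \<langle>$\<rangle> m)"
  by (simp add: apply_times)

lemma Sym_fixes: "g \<in> Sym n \<Longrightarrow> m \<notin> {1..n} \<Longrightarrow> g \<langle>$\<rangle> m = m"
  by (auto simp: Sym_def in_affected)

lemma Sym_apply_in [simp]:
  assumes "g \<in> Sym n"
  shows "g \<langle>$\<rangle> m \<in> {1..n} \<longleftrightarrow> m \<in> {1..n}"
  by (metis Sym_fixes apply_inverse_cancel(1) assms)

lemma Sym_eqI:
  assumes "g \<in> Sym n" "h \<in> Sym n" "\<And>m. m \<in> {1..n} \<Longrightarrow> g \<langle>$\<rangle> m = h \<langle>$\<rangle> m"
  shows "g = h"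
  by (rule perm_eqI) (metis Sym_fixes assms)

lemma Sym_apply_permutes: "g \<in> Sym n \<Longrightarrow> apply g permutes {1..n}"
  unfolding permutes_def by (metis Sym_fixes apply_inverse_cancel)

lemma Sym_of_bij:
  assumes "bij_betw f {1..n} {1..n}"
  obtains g where "g \<in> Sym n" "\<And>m. m \<in> {1..n} \<Longrightarrow> g \<langle>$\<rangle> m = f m"
proof -
  define f' where "f' m = (if m \<in> {1..n} then f m else m)" for m
  have "bij_betw f' {1..n} {1..n} \<longleftrightarrow> bij_betw f {1..n} {1..n}"
    by (rule bij_betw_cong) (simp add: f'_def)
  with assms have "bij_betw f' {1..n} {1..n}" by simp
  then have "f' permutes {1..n}"
    by (rule bij_imp_permutes) (auto simp: f'_def)
  moreover have fin: "finite {m. f' m \<noteq> m}"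
    by (rule finite_subset[of _ "{1..n}"]) (auto simp: f'_def)
  ultimately have "apply (Perm f') = f'"
    by (simp add: Perm_inverse permutes_bij)
  then have "Perm f' \<in> Sym n" "\<And>m. m \<in> {1..n} \<Longrightarrow> Perm f' \<langle>$\<rangle> m = f m"
    by (auto simp: Sym_def in_affected f'_def split: if_splits)
  then show ?thesis ..
qed

lemma bij_betw_apply_Sym: "bij_betw apply (Sym n) {p. p permutes {1..n}}"
proof (rule bij_betw_imageI)
  show "inj_on apply (Sym n)"
    by (auto simp: inj_on_def intro!: perm_eqI)
  show "apply ` Sym n = {p. p permutes {1..n}}"
  proof (intro equalityI subsetI)
    fix p assume "p \<in> {p. p permutes {1..n}}"
    then have p: "p permutes {1..n}" by simp
    obtain g where g: "g \<in> Sym n" "\<And>m. m \<in> {1..n} \<Longrightarrow> g \<langle>$\<rangle> m = p m"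
      using Sym_of_bij[OF permutes_imp_bij[OF p]] by blast
    have "apply g = p"
      using g p by (metis Sym_fixes ext permutes_not_in)
    then show "p \<in> apply ` Sym n" using g by auto
  qed (use Sym_apply_permutes in blast)
qed

lemma finite_Sym [simp]: "finite (Sym n)"
  using bij_betw_finite[OF bij_betw_apply_Sym, of n] finite_permutations[of "{1..n}"] by simp

lemma card_Sym: "card (Sym n) = fact n"
  using bij_betw_same_card[OF bij_betw_apply_Sym, of n] card_permutations[of "{1..n}" n] by simp

lemma swap_conj: "g * \<langle>i \<leftrightarrow> j\<rangle> = \<langle>g \<langle>$\<rangle> i \<leftrightarrow> g \<langle>$\<rangle> j\<rangle> * g"
proof (rule perm_eqI)
  fix m
  show "(g * \<langle>i \<leftrightarrow> j\<rangle>) \<langle>$\<rangle> m = (\<langle>g \<langle>$\<rangle> i \<leftrightarrow> g \<langle>$\<rangle> j\<rangle> * g) \<langle>$\<rangle> m"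
    by (cases "m = i"; cases "m = j"; simp add: apply_inj)
qed

lemma sum_Sym_left:
  assumes "k \<in> Sym n"
  shows "(\<Sum>g\<in>Sym n. F (k * g)) = (\<Sum>g\<in>Sym n. F g)"
  by (rule sum.reindex_bij_witness[of _ "\<lambda>g. inverse k * g" "\<lambda>g. k * g"])
     (use assms in \<open>auto simp: mult.assoc[symmetric]\<close>)


section \<open>The group algebra of a symmetric group\<close>

lemma Sym_algebra_expand:
  assumes "x \<in> Sym_algebra n"
  shows "x = (\<Sum>g\<in>Sym n. ga_scale (ga_coeff x g) (of_perm g))"
  using assms by (intro ga_expand) (auto simp: Sym_algebra_def)

lemma subspace_Sym_algebra: "ga.subspace (Sym_algebra n)"
  by (auto simp: ga.subspace_def Sym_algebra_def in_keys_iff subset_iff lookup_add)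
     (metis add.right_neutral)

lemma of_perm_in_Sym_algebra [intro]: "g \<in> Sym n \<Longrightarrow> of_perm g \<in> Sym_algebra n"
  by (auto simp: Sym_algebra_def of_perm_def)

lemma Sym_algebra_mult [intro]:
  "x \<in> Sym_algebra n \<Longrightarrow> y \<in> Sym_algebra n \<Longrightarrow> x * y \<in> Sym_algebra n"
  unfolding Sym_algebra_def mem_Collect_eq
  by (rule order.trans[OF keys_mult]) (auto simp: plus_perm_def)

lemma Sym_algebra_one [simp]: "1 \<in> Sym_algebra n"
  using of_perm_in_Sym_algebra[of 1 n] by simp

lemma Sym_algebra_scale [intro]: "x \<in> Sym_algebra n \<Longrightarrow> ga_scale a x \<in> Sym_algebra n"
  by (rule ga.subspace_scale[OF subspace_Sym_algebra])

lemma Sym_algebra_add [intro]: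
  "x \<in> Sym_algebra n \<Longrightarrow> y \<in> Sym_algebra n \<Longrightarrow> x + y \<in> Sym_algebra n"
  by (rule ga.subspace_add[OF subspace_Sym_algebra])

lemma Sym_algebra_sum [intro]:
  "(\<And>i. i \<in> I \<Longrightarrow> x i \<in> Sym_algebra n) \<Longrightarrow> (\<Sum>i\<in>I. x i) \<in> Sym_algebra n"
  by (rule ga.subspace_sum[OF subspace_Sym_algebra])

lemma Sym_algebra_eq_span: "Sym_algebra n = ga.span (of_perm ` Sym n)"
proof (intro equalityI subsetI)
  fix x :: "'a group_algebra" assume "x \<in> Sym_algebra n"
  then show "x \<in> ga.span (of_perm ` Sym n)"
    by (subst Sym_algebra_expand, assumption)
       (intro ga.span_sum ga.span_scale ga.span_base imageI)
next
  fix x :: "'a group_algebra" assume "x \<in> ga.span (of_perm ` Sym n)"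
  moreover have "ga.span (of_perm ` Sym n) \<subseteq> (Sym_algebra n :: 'a group_algebra set)"
    by (rule ga.span_minimal[OF _ subspace_Sym_algebra]) auto
  ultimately show "x \<in> Sym_algebra n" by blast
qed

definition commutes_with_Sym :: "nat \<Rightarrow> 'a::field group_algebra \<Rightarrow> bool" where
  "commutes_with_Sym n x \<longleftrightarrow> (\<forall>g\<in>Sym n. of_perm g * x = x * of_perm g)"

lemma commutes_with_Sym_algebra:
  assumes "commutes_with_Sym n x" "y \<in> Sym_algebra n"
  shows "y * x = x * y"
  using assms(1)
  by (subst (1 2) Sym_algebra_expand[OF assms(2)])
     (simp add: commutes_with_Sym_def sum_distrib_left sum_distrib_right ga_scale_mult_left
        ga_scale_mult_right)

lemma ga_coeff_conj:
  assumes "commutes_with_Sym n x" "k \<in> Sym n"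
  shows "ga_coeff x (k * g * inverse k) = ga_coeff x g"
proof -
  have "ga_coeff x (k * g * inverse k) = ga_coeff (x * of_perm k) (k * g)"
    by (simp add: ga_coeff_mult_of_perm)
  also have "\<dots> = ga_coeff (of_perm k * x) (k * g)"
    using assms by (simp add: commutes_with_Sym_def)
  also have "\<dots> = ga_coeff x g"
    by (simp add: ga_coeff_of_perm_mult mult.assoc[symmetric])
  finally show ?thesis .
qed


section \<open>Partitions and their row-by-row tableaux\<close>

lemma partitions_ofD:
  assumes "\<mu> \<in> partitions_of n"
  shows "sorted_wrt (\<ge>) \<mu>" "0 \<notin> set \<mu>" "sum_list \<mu> = n"
  using assms by (auto simp: partitions_of_def)

lemma finite_cells [simp]: "finite (cells \<mu>)"
proof -
  have "cells \<mu> = Sigma {..<length \<mu>} (\<lambda>i. {..<\<mu> ! i})"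
    by (auto simp: cells_def)
  then show ?thesis by simp
qed

lemma card_cells: "card (cells \<mu>) = sum_list \<mu>"
proof -
  have "cells \<mu> = Sigma {..<length \<mu>} (\<lambda>i. {..<\<mu> ! i})"
    by (auto simp: cells_def)
  then show ?thesis
    by (simp add: sum_list_sum_nth atLeast0LessThan)
qed

lemma sum_list_take_Suc: "i < length \<mu> \<Longrightarrow> sum_list (take (Suc i) \<mu>) = sum_list (take i \<mu>) + \<mu> ! i"
  for \<mu> :: "nat list"
  by (simp add: take_Suc_conv_app_nth)

lemma sum_list_take_mono: "i \<le> k \<Longrightarrow> sum_list (take i \<mu>) \<le> sum_list (take k \<mu>)"
  for \<mu> :: "nat list"
proof -
  assume "i \<le> k"
  then have "take k \<mu> = take i \<mu> @ take (k - i) (drop i \<mu>)"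
    by (metis le_add_diff_inverse take_add)
  then show ?thesis by simp
qed

lemma tableau_less:
  assumes "(i, j) \<in> cells \<mu>" "i < i'"
  shows "tableau \<mu> (i, j) < tableau \<mu> (i', j')"
proof -
  have "sum_list (take i \<mu>) + \<mu> ! i \<le> sum_list (take i' \<mu>)"
    using assms sum_list_take_mono[of "Suc i" i' \<mu>] by (simp add: cells_def sum_list_take_Suc)
  then show ?thesis
    using assms(1) by (simp add: tableau_def cells_def)
qed

lemma inj_on_tableau: "inj_on (tableau \<mu>) (cells \<mu>)"
proof (rule inj_onI)
  fix c d assume *: "c \<in> cells \<mu>" "d \<in> cells \<mu>" "tableau \<mu> c = tableau \<mu> d"
  obtain i j i' j' where cd: "c = (i, j)" "d = (i', j')" by (cases c; cases d)
  have "i = i'"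
    using tableau_less[of i j \<mu> i' j'] tableau_less[of i' j' \<mu> i j] * cd
    by (metis less_irrefl linorder_neqE_nat)
  then show "c = d"
    using * cd by (simp add: tableau_def)
qed

lemma bij_betw_tableau: "bij_betw (tableau \<mu>) (cells \<mu>) {1..sum_list \<mu>}"
proof -
  have "tableau \<mu> ` cells \<mu> \<subseteq> {1..sum_list \<mu>}"
  proof safe
    fix i j assume ij: "(i, j) \<in> cells \<mu>"
    have "sum_list (take (Suc i) \<mu>) \<le> sum_list (take (length \<mu>) \<mu>)"
      using ij by (intro sum_list_take_mono) (auto simp: cells_def)
    then show "tableau \<mu> (i, j) \<in> {1..sum_list \<mu>}"
      using ij by (auto simp: tableau_def cells_def sum_list_take_Suc)
  qed
  moreover have "card (tableau \<mu> ` cells \<mu>) = card {1..sum_list \<mu>}"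
    by (simp add: card_image inj_on_tableau card_cells)
  ultimately have "tableau \<mu> ` cells \<mu> = {1..sum_list \<mu>}"
    by (intro card_subset_eq) auto
  then show ?thesis
    using inj_on_tableau by (simp add: bij_betw_def)
qed


section \<open>Cycle types\<close>

lemma Sym_power: "g \<in> Sym n \<Longrightarrow> g ^ k \<in> Sym n"
  by (induction k) auto

lemma orbit_subset_Sym: "g \<in> Sym n \<Longrightarrow> m \<in> {1..n} \<Longrightarrow> orbit g m \<subseteq> {1..n}"
  unfolding orbit_def using Sym_power[of g n] Sym_apply_in by blast

lemma UN_orbits: "g \<in> Sym n \<Longrightarrow> \<Union>(orbit g ` {1..n}) = {1..n}"
  by (rule equalityI, rule UN_least, erule orbit_subset_Sym, assumption) force

lemma disjoint_orbits: "pairwise disjnt (orbit g ` A)"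
proof (rule pairwiseI)
  fix X Y assume "X \<in> orbit g ` A" "Y \<in> orbit g ` A" "X \<noteq> Y"
  then show "disjnt X Y"
    unfolding disjnt_def using orbit_disjoint by (elim imageE) simp
qed

lemma sum_mset_cycle_type:
  assumes "g \<in> Sym n"
  shows "sum_mset (cycle_type n g) = n"
proof -
  have "sum_mset (cycle_type n g) = (\<Sum>X\<in>orbit g ` {1..n}. card X)"
    by (simp add: cycle_type_def sum_unfold_sum_mset)
  also have "\<dots> = card (\<Union>(orbit g ` {1..n}))"
    by (rule card_Union_disjoint[symmetric]) (auto simp: disjoint_orbits)
  also have "\<dots> = n"
    by (simp add: UN_orbits[OF assms, simplified])
  finally show ?thesis .
qed

lemma ex_partition_of_cycle_type:
  assumes "g \<in> Sym n"
  obtains \<alpha> where "\<alpha> \<in> partitions_of n" "g \<in> conj_class n \<alpha>"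
proof -
  define \<alpha> where "\<alpha> = rev (sorted_list_of_multiset (cycle_type n g))"
  have mset: "mset \<alpha> = cycle_type n g"
    by (simp add: \<alpha>_def)
  have "0 \<notin># cycle_type n g"
    by (auto simp: cycle_type_def card_eq_0_iff simp del: card_orbit_eq)
  then have "0 \<notin> set \<alpha>"
    by (metis mset set_mset_mset)
  moreover have "sum_list \<alpha> = n"
    using sum_mset_cycle_type[OF assms] mset by (metis sum_mset_sum_list)
  moreover have "sorted_wrt (\<ge>) \<alpha>"
    by (simp add: \<alpha>_def sorted_wrt_rev)
  ultimately have "\<alpha> \<in> partitions_of n"
    by (simp add: partitions_of_def)
  with assms mset show ?thesis
    by (intro that[of \<alpha>]) (auto simp: conj_class_def)
qed

lemma partitions_of_mset_eq:
  assumes "\<alpha> \<in> partitions_of n" "\<beta> \<in> partitions_of n" "mset \<alpha> = mset \<beta>"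
  shows "\<alpha> = \<beta>"
proof -
  have "sorted (rev \<alpha>)" "sorted (rev \<beta>)"
    using assms(1,2) by (auto simp: partitions_of_def sorted_wrt_rev)
  then have "rev \<alpha> = rev \<beta>"
    using assms(3) by (metis mset_rev properties_for_sort)
  then show ?thesis by simp
qed

lemma conj_class_disjoint:
  "\<alpha> \<in> partitions_of n \<Longrightarrow> \<beta> \<in> partitions_of n \<Longrightarrow> g \<in> conj_class n \<alpha> \<Longrightarrow> g \<in> conj_class n \<beta> \<Longrightarrow> \<alpha> = \<beta>"
  by (rule partitions_of_mset_eq) (auto simp: conj_class_def)

lemma finite_conj_class [simp]: "finite (conj_class n \<alpha>)"
  by (simp add: conj_class_def)

lemma conj_class_inverse: "g \<in> conj_class n \<alpha> \<Longrightarrow> inverse g \<in> conj_class n \<alpha>"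
  by (simp add: conj_class_def cycle_type_def)

definition cell_rotate :: "nat list \<Rightarrow> nat \<times> nat \<Rightarrow> nat \<times> nat" where
  "cell_rotate \<alpha> c = (fst c, Suc (snd c) mod \<alpha> ! fst c)"

lemma cell_rotate_in: "c \<in> cells \<alpha> \<Longrightarrow> cell_rotate \<alpha> c \<in> cells \<alpha>"
  by (auto simp: cells_def cell_rotate_def)

lemma inj_on_cell_rotate: "inj_on (cell_rotate \<alpha>) (cells \<alpha>)"
  by (auto simp: inj_on_def cells_def cell_rotate_def mod_Suc split: if_splits)

text \<open>
  Choosing a starting point in each orbit identifies the action of \<open>g\<close> on \<open>{1..n}\<close> with the rotation
  of the rows of the diagram of \<open>\<alpha>\<close>. Two permutations of the same cycle type are thus models of the
  same map on cells, which makes them conjugate.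
\<close>

lemma conj_class_labelling:
  assumes "g \<in> conj_class n \<alpha>"
  obtains \<phi> where "bij_betw \<phi> (cells \<alpha>) {1..n}"
    "\<And>c. c \<in> cells \<alpha> \<Longrightarrow> g \<langle>$\<rangle> (\<phi> c) = \<phi> (cell_rotate \<alpha> c)"
proof -
  have g: "g \<in> Sym n" and ct: "cycle_type n g = mset \<alpha>"
    using assms by (auto simp: conj_class_def)
  define Os where "Os = orbit g ` {1..n}"
  \<comment> \<open>list the orbits in an order in which their sizes are the parts of \<open>\<alpha>\<close>\<close>
  obtain os where os: "mset os = mset_set Os" "map card os = \<alpha>"
  proof -
    obtain xs where xs: "mset xs = mset_set Os" using ex_mset by blast
    then have "mset (map card xs) = mset \<alpha>"
      using ct by (simp add: cycle_type_def Os_def)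
    then obtain p where p: "p permutes {..<length xs}" "permute_list p (map card xs) = \<alpha>"
      by (metis length_map mset_eq_permutation)
    have "map card (permute_list p xs) = \<alpha>"
      using p by (simp add: permute_list_map)
    moreover have "mset (permute_list p xs) = mset_set Os"
      using p xs by simp
    ultimately show ?thesis by (intro that) auto
  qed
  have fin: "finite Os" by (simp add: Os_def)
  have set_os: "set os = Os"
    by (metis os(1) fin finite_set_mset_mset_set set_mset_mset)
  have dist: "distinct os"
    by (simp add: distinct_count_atmost_1 os(1) set_os fin count_mset_set')
  have len: "length os = length \<alpha>" using os(2) by auto
  define rep where "rep X = (SOME m. m \<in> X)" for X :: "nat set"
  have rep: "rep X \<in> {1..n}" "orbit g (rep X) = X" if "X \<in> Os" for X
  proof -
    from that obtain m where m: "m \<in> {1..n}" "X = orbit g m" by (auto simp: Os_def)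
    then have "rep X \<in> X"
      unfolding rep_def by (metis in_orbit_self someI)
    then show "rep X \<in> {1..n}"
      using orbit_subset_Sym[OF g m(1)] unfolding m(2) by (rule subsetD[rotated])
    show "orbit g (rep X) = X"
      using orbit_equiv[of "rep X" g m] \<open>rep X \<in> X\<close> m(2) by simp
  qed
  have osi: "os ! i \<in> Os" if "i < length \<alpha>" for i
    using that len set_os by (metis nth_mem)
  have ord: "order g (rep (os ! i)) = \<alpha> ! i" if "i < length \<alpha>" for i
  proof -
    have "order g (rep (os ! i)) = card (os ! i)"
      by (simp only: rep(2)[OF osi[OF that]] card_orbit_eq[symmetric])
    also have "\<dots> = map card os ! i"
      by (rule nth_map[symmetric]) (simp only: len that)
    finally show ?thesis
      by (simp only: os(2))
  qed
  define \<phi> where "\<phi> c = (g ^ snd c) \<langle>$\<rangle> (rep (os ! fst c))" for c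
  have "inj_on \<phi> (cells \<alpha>)"
  proof (rule inj_onI)
    fix c d assume cd: "c \<in> cells \<alpha>" "d \<in> cells \<alpha>" "\<phi> c = \<phi> d"
    then have lt: "fst c < length \<alpha>" "fst d < length \<alpha>" by (auto simp: cells_def)
    have "orbit g (rep (os ! fst c)) = orbit g (rep (os ! fst d))"
      using cd(3) unfolding \<phi>_def by (metis orbit_apply_power)
    then have "os ! fst c = os ! fst d"
      by (simp add: rep(2)[OF osi] lt)
    then have *: "fst c = fst d"
      using dist lt len by (simp add: nth_eq_iff_index_eq)
    have "snd c mod \<alpha> ! fst c = snd d mod \<alpha> ! fst c"
      using cd(3) lt unfolding \<phi>_def * by (simp add: apply_power_eq_iff ord)
    then show "c = d"
      using cd(1,2) * by (auto simp: cells_def prod_eq_iff)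
  qed
  moreover have "\<phi> ` cells \<alpha> \<subseteq> {1..n}"
  proof safe
    fix i j assume ij: "(i, j) \<in> cells \<alpha>"
    then have "i < length \<alpha>" by (auto simp: cells_def)
    then show "\<phi> (i, j) \<in> {1..n}"
      unfolding \<phi>_def fst_conv by (simp only: Sym_apply_in[OF Sym_power[OF g]] rep(1)[OF osi])
  qed
  moreover have "card (cells \<alpha>) = card {1..n}"
    using sum_mset_cycle_type[OF g] ct by (simp add: card_cells sum_mset_sum_list)
  ultimately have "bij_betw \<phi> (cells \<alpha>) {1..n}"
    by (metis bij_betw_def card_image card_subset_eq finite_atLeastAtMost)
  moreover have "g \<langle>$\<rangle> (\<phi> c) = \<phi> (cell_rotate \<alpha> c)" if "c \<in> cells \<alpha>" for c
  proof -
    have *: "fst c < length \<alpha>" using that by (auto simp: cells_def)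
    have "g \<langle>$\<rangle> (\<phi> c) = (g ^ Suc (snd c)) \<langle>$\<rangle> (rep (os ! fst c))"
      by (simp add: \<phi>_def)
    also have "\<dots> = (g ^ (Suc (snd c) mod \<alpha> ! fst c)) \<langle>$\<rangle> (rep (os ! fst c))"
      by (metis * apply_power_mod_order_eq ord)
    finally show ?thesis
      by (simp add: \<phi>_def cell_rotate_def)
  qed
  ultimately show ?thesis ..
qed

lemma conj_class_conjugate:
  assumes "g \<in> conj_class n \<alpha>" "h \<in> conj_class n \<alpha>"
  obtains k where "k \<in> Sym n" "h = k * g * inverse k"
proof -
  have gh: "g \<in> Sym n" "h \<in> Sym n" using assms by (auto simp: conj_class_def)
  obtain \<phi> where \<phi>: "bij_betw \<phi> (cells \<alpha>) {1..n}"
    "\<And>c. c \<in> cells \<alpha> \<Longrightarrow> g \<langle>$\<rangle> (\<phi> c) = \<phi> (cell_rotate \<alpha> c)"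
    using conj_class_labelling[OF assms(1)] by blast
  obtain \<psi> where \<psi>: "bij_betw \<psi> (cells \<alpha>) {1..n}"
    "\<And>c. c \<in> cells \<alpha> \<Longrightarrow> h \<langle>$\<rangle> (\<psi> c) = \<psi> (cell_rotate \<alpha> c)"
    using conj_class_labelling[OF assms(2)] by blast
  obtain k where k: "k \<in> Sym n"
    "\<And>m. m \<in> {1..n} \<Longrightarrow> k \<langle>$\<rangle> m = (\<psi> \<circ> the_inv_into (cells \<alpha>) \<phi>) m"
    using Sym_of_bij[OF bij_betw_trans[OF bij_betw_the_inv_into[OF \<phi>(1)] \<psi>(1)]] by blast
  have k\<phi>: "k \<langle>$\<rangle> (\<phi> c) = \<psi> c" if "c \<in> cells \<alpha>" for c
    using that \<phi>(1) k(2)[OF bij_betwE[OF \<phi>(1), rule_format, OF that]]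
    by (simp add: bij_betw_def the_inv_into_f_f)
  have "h * k = k * g"
  proof (rule Sym_eqI)
    fix m assume "m \<in> {1..n}"
    then have "m \<in> \<phi> ` cells \<alpha>"
      by (simp only: bij_betw_imp_surj_on[OF \<phi>(1)])
    then obtain c where c: "c \<in> cells \<alpha>" "m = \<phi> c"
      by (elim imageE)
    then show "(h * k) \<langle>$\<rangle> m = (k * g) \<langle>$\<rangle> m"
      by (simp add: k\<phi> \<phi>(2) \<psi>(2) cell_rotate_in)
  qed (use gh k in auto)
  then have "h = k * g * inverse k"
    by (metis mult.assoc mult.right_neutral perm.right_inverse)
  with k(1) show ?thesis ..
qed

lemma cell_rotate_orbit:
  assumes "bij_betw \<phi> (cells \<alpha>) {1..n}"
    "\<And>c. c \<in> cells \<alpha> \<Longrightarrow> g \<langle>$\<rangle> (\<phi> c) = \<phi> (cell_rotate \<alpha> c)" "(i, j) \<in> cells \<alpha>"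
  shows "orbit g (\<phi> (i, j)) = (\<lambda>j. \<phi> (i, j)) ` {..<\<alpha> ! i}"
proof -
  have i: "i < length \<alpha>" "j < \<alpha> ! i" using assms(3) by (auto simp: cells_def)
  have pow: "(g ^ k) \<langle>$\<rangle> (\<phi> (i, j)) = \<phi> (i, (j + k) mod \<alpha> ! i)" for k
  proof (induction k)
    case 0 then show ?case using i by simp
  next
    case (Suc k)
    have "(i, (j + k) mod \<alpha> ! i) \<in> cells \<alpha>" using i by (simp add: cells_def)
    then show ?case
      using Suc by (simp add: assms(2) cell_rotate_def mod_Suc_eq)
  qed
  show ?thesis
  proof (intro equalityI subsetI)
    fix m assume "m \<in> orbit g (\<phi> (i, j))"
    then show "m \<in> (\<lambda>j. \<phi> (i, j)) ` {..<\<alpha> ! i}"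
      using i by (auto simp: orbit_def pow)
  next
    fix m assume "m \<in> (\<lambda>j. \<phi> (i, j)) ` {..<\<alpha> ! i}"
    then obtain k where k: "k < \<alpha> ! i" "m = \<phi> (i, k)" by auto
    then have "(j + (\<alpha> ! i - j + k)) mod \<alpha> ! i = k" using i by simp
    then have "m = (g ^ (\<alpha> ! i - j + k)) \<langle>$\<rangle> (\<phi> (i, j))"
      unfolding pow k(2) by simp
    then show "m \<in> orbit g (\<phi> (i, j))" by simp
  qed
qed

text \<open>
  Rotating the rows of the tableau gives a permutation of the wanted cycle type. Without it, a class
  sum could be 0 and the class sums would not be independent.
\<close>

lemma conj_class_nonempty:
  assumes "\<alpha> \<in> partitions_of n"
  shows "conj_class n \<alpha> \<noteq> {}"
proof -
  let ?T = "tableau \<alpha>"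
  note \<alpha> = partitions_ofD[OF assms]
  have T: "bij_betw ?T (cells \<alpha>) {1..n}"
    using bij_betw_tableau[of \<alpha>] \<alpha>(3) by simp
  have "cell_rotate \<alpha> ` cells \<alpha> = cells \<alpha>"
    by (rule card_subset_eq) (auto simp: card_image inj_on_cell_rotate cell_rotate_in)
  then have "bij_betw (cell_rotate \<alpha>) (cells \<alpha>) (cells \<alpha>)"
    by (simp add: bij_betw_def inj_on_cell_rotate)
  then obtain g where g: "g \<in> Sym n"
    "\<And>m. m \<in> {1..n} \<Longrightarrow> g \<langle>$\<rangle> m = (?T \<circ> (cell_rotate \<alpha> \<circ> the_inv_into (cells \<alpha>) ?T)) m"
    using Sym_of_bij[OF bij_betw_trans[OF bij_betw_trans[OF bij_betw_the_inv_into[OF T]] T]] by blast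
  have gT: "g \<langle>$\<rangle> (?T c) = ?T (cell_rotate \<alpha> c)" if "c \<in> cells \<alpha>" for c
    using that T g(2)[OF bij_betwE[OF T, rule_format, OF that]]
    by (simp add: bij_betw_def the_inv_into_f_f)
  define row where "row i = (\<lambda>j. ?T (i, j)) ` {..<\<alpha> ! i}" for i
  have pos: "0 < \<alpha> ! i" if "i < length \<alpha>" for i
    using that \<alpha>(2) by (metis gr0I nth_mem)
  have orbits: "orbit g ` {1..n} = row ` {..<length \<alpha>}"
  proof -
    have "orbit g ` {1..n} = (\<lambda>c. orbit g (?T c)) ` cells \<alpha>"
      unfolding bij_betw_imp_surj_on[OF T, symmetric] image_image ..
    also have "\<dots> = (\<lambda>c. row (fst c)) ` cells \<alpha>"
    proof (rule image_cong[OF refl])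
      fix c assume "c \<in> cells \<alpha>"
      then show "orbit g (?T c) = row (fst c)"
        using cell_rotate_orbit[OF T gT, of "fst c" "snd c"] by (simp add: row_def)
    qed
    also have "\<dots> = row ` fst ` cells \<alpha>"
      by (simp add: image_image)
    also have "fst ` cells \<alpha> = {..<length \<alpha>}"
      using pos by (force simp: cells_def image_iff)
    finally show ?thesis .
  qed
  have inj_T: "inj_on (\<lambda>j. ?T (i, j)) {..<\<alpha> ! i}" if "i < length \<alpha>" for i
    by (auto simp: inj_on_def tableau_def)
  have "inj_on row {..<length \<alpha>}"
  proof (rule inj_onI)
    fix i i' assume *: "i \<in> {..<length \<alpha>}" "i' \<in> {..<length \<alpha>}" "row i = row i'"
    then have "?T (i, 0) \<in> row i'" using pos[of i] by (auto simp: row_def)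
    then obtain j where "j < \<alpha> ! i'" "?T (i, 0) = ?T (i', j)" by (auto simp: row_def)
    then show "i = i'"
      using inj_onD[OF inj_on_tableau, of \<alpha> "(i, 0)" "(i', j)"] * pos[of i]
      by (auto simp: cells_def)
  qed
  then have "cycle_type n g = image_mset (card \<circ> row) (mset_set {..<length \<alpha>})"
    unfolding cycle_type_def orbits by (simp add: multiset.map_comp flip: image_mset_mset_set)
  also have "\<dots> = image_mset (nth \<alpha>) (mset_set {..<length \<alpha>})"
    by (rule image_mset_cong) (simp add: row_def card_image inj_T)
  also have "\<dots> = mset (map (nth \<alpha>) [0..<length \<alpha>])"
    by (simp add: atLeast0LessThan)
  finally show ?thesis
    using g(1) by (auto simp: conj_class_def map_nth)
qed

lemma conj_class_replicate_one: "conj_class n (replicate n 1) = {1}"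
proof (intro equalityI subsetI)
  fix g assume "g \<in> conj_class n (replicate n 1)"
  then have g: "g \<in> Sym n" "cycle_type n g = replicate_mset n 1"
    by (auto simp: conj_class_def)
  have "g \<langle>$\<rangle> m = 1 \<langle>$\<rangle> m" if "m \<in> {1..n}" for m
  proof -
    have "card (orbit g m) \<in># cycle_type n g"
      unfolding cycle_type_def using that by (auto simp del: card_orbit_eq)
    then have "order g m = Suc 0"
      unfolding g(2) by (auto split: if_splits)
    then show ?thesis
      by (simp add: order_eq_one_iff in_affected)
  qed
  then have "g = 1"
    using g(1) by (intro Sym_eqI[of _ n]) auto
  then show "g \<in> {1}" by simp
next
  fix g :: "nat perm" assume "g \<in> {1}"
  moreover have "orbit (1 :: nat perm) ` {1..n} = (\<lambda>m. {m}) ` {1..n}" by simp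
  then have "cycle_type n (1 :: nat perm) = image_mset (card \<circ> (\<lambda>m. {m})) (mset_set {1..n})"
    unfolding cycle_type_def by (simp flip: image_mset_mset_set add: inj_on_def multiset.map_comp)
  then have "cycle_type n (1 :: nat perm) = replicate_mset n 1"
    by (simp add: image_mset_const_eq comp_def)
  ultimately show "g \<in> conj_class n (replicate n 1)"
    by (simp add: conj_class_def)
qed

lemma finite_partitions_of [simp]: "finite (partitions_of n)"
proof (rule finite_surj[of "Sym n"])
  show "partitions_of n \<subseteq> (\<lambda>g. THE \<alpha>. \<alpha> \<in> partitions_of n \<and> g \<in> conj_class n \<alpha>) ` Sym n"
  proof
    fix \<alpha> assume \<alpha>: "\<alpha> \<in> partitions_of n"
    then obtain g where g: "g \<in> conj_class n \<alpha>" using conj_class_nonempty by blast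
    then have "(THE \<alpha>. \<alpha> \<in> partitions_of n \<and> g \<in> conj_class n \<alpha>) = \<alpha>"
      using \<alpha> conj_class_disjoint by blast
    with g show "\<alpha> \<in> (\<lambda>g. THE \<alpha>. \<alpha> \<in> partitions_of n \<and> g \<in> conj_class n \<alpha>) ` Sym n"
      by (metis (mono_tags, lifting) conj_class_def imageI mem_Collect_eq)
  qed
qed simp


section \<open>Row and column coordinates\<close>

definition row_of :: "nat list \<Rightarrow> nat \<Rightarrow> nat" where
  "row_of \<mu> m = fst (the_inv_into (cells \<mu>) (tableau \<mu>) m)"

definition col_of :: "nat list \<Rightarrow> nat \<Rightarrow> nat" where
  "col_of \<mu> m = snd (the_inv_into (cells \<mu>) (tableau \<mu>) m)"

lemma row_of_tableau [simp]: "c \<in> cells \<mu> \<Longrightarrow> row_of \<mu> (tableau \<mu> c) = fst c"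
  by (simp add: row_of_def the_inv_into_f_f inj_on_tableau)

lemma col_of_tableau [simp]: "c \<in> cells \<mu> \<Longrightarrow> col_of \<mu> (tableau \<mu> c) = snd c"
  by (simp add: col_of_def the_inv_into_f_f inj_on_tableau)

context
  fixes \<mu> :: "nat list" and n :: nat
  assumes \<mu>: "\<mu> \<in> partitions_of n"
begin

lemma tableau_in: "c \<in> cells \<mu> \<Longrightarrow> tableau \<mu> c \<in> {1..n}"
  using bij_betw_tableau[of \<mu>] partitions_ofD(3)[OF \<mu>] by (auto dest: bij_betwE)

lemma ex_cell:
  assumes "m \<in> {1..n}"
  obtains c where "c \<in> cells \<mu>" "m = tableau \<mu> c"
proof -
  have "m \<in> tableau \<mu> ` cells \<mu>"
    using assms partitions_ofD(3)[OF \<mu>] by (simp only: bij_betw_imp_surj_on[OF bij_betw_tableau])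
  then show ?thesis using that by blast
qed

lemma coordinates_in_cells: "m \<in> {1..n} \<Longrightarrow> (row_of \<mu> m, col_of \<mu> m) \<in> cells \<mu>"
  by (elim ex_cell) simp

lemma tableau_coordinates: "m \<in> {1..n} \<Longrightarrow> tableau \<mu> (row_of \<mu> m, col_of \<mu> m) = m"
  by (elim ex_cell) simp

lemma bij_betw_tableau_partition: "bij_betw (tableau \<mu>) (cells \<mu>) {1..n}"
  using bij_betw_tableau[of \<mu>] partitions_ofD(3)[OF \<mu>] by simp

lemma card_coordinates:
  "card {m \<in> {1..n}. P (row_of \<mu> m) (col_of \<mu> m)} = card {c \<in> cells \<mu>. P (fst c) (snd c)}"
proof -
  have "bij_betw (tableau \<mu>) {c \<in> cells \<mu>. P (fst c) (snd c)}
      {m \<in> {1..n}. P (row_of \<mu> m) (col_of \<mu> m)}"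
  proof (rule bij_betw_imageI)
    show "inj_on (tableau \<mu>) {c \<in> cells \<mu>. P (fst c) (snd c)}"
      by (rule inj_on_subset[OF inj_on_tableau]) auto
    show "tableau \<mu> ` {c \<in> cells \<mu>. P (fst c) (snd c)} = {m \<in> {1..n}. P (row_of \<mu> m) (col_of \<mu> m)}"
    proof (intro equalityI subsetI)
      fix m assume *: "m \<in> {m \<in> {1..n}. P (row_of \<mu> m) (col_of \<mu> m)}"
      then obtain c where "c \<in> cells \<mu>" "m = tableau \<mu> c" using ex_cell by blast
      with * show "m \<in> tableau \<mu> ` {c \<in> cells \<mu>. P (fst c) (snd c)}" by auto
    qed (use tableau_in in auto)
  qed
  then show ?thesis by (simp add: bij_betw_same_card)
qed

end


section \<open>Symmetrizing and antisymmetrizing sums\<close>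

text \<open>
  For \<open>f\<close> the row or the column of an entry this is the row or the column group. A symmetrizing sum
  absorbs the elements of the group, an antisymmetrizing sum does so up to their sign.
\<close>

definition stabilizer :: "nat \<Rightarrow> (nat \<Rightarrow> 'b) \<Rightarrow> nat perm set" where
  "stabilizer n f = {g \<in> Sym n. \<forall>m\<in>{1..n}. f (g \<langle>$\<rangle> m) = f m}"

definition perm_sign :: "nat perm \<Rightarrow> 'a::field" where
  "perm_sign g = of_int (sign (apply g))"

definition sym_sum :: "nat \<Rightarrow> (nat \<Rightarrow> 'b) \<Rightarrow> 'a::field group_algebra" where
  "sym_sum n f = (\<Sum>g\<in>stabilizer n f. of_perm g)"

definition alt_sum :: "nat \<Rightarrow> (nat \<Rightarrow> 'b) \<Rightarrow> 'a::field group_algebra" where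
  "alt_sum n f = (\<Sum>g\<in>stabilizer n f. ga_scale (perm_sign g) (of_perm g))"

lemma stabilizer_subset_Sym: "stabilizer n f \<subseteq> Sym n"
  by (auto simp: stabilizer_def)

lemma finite_stabilizer [simp]: "finite (stabilizer n f)"
  by (rule finite_subset[OF stabilizer_subset_Sym]) simp

lemma stabilizer_one: "1 \<in> stabilizer n f"
  by (simp add: stabilizer_def)

lemma stabilizer_mult:
  assumes "g \<in> stabilizer n f" "h \<in> stabilizer n f"
  shows "g * h \<in> stabilizer n f"
  using assms Sym_apply_in[of h n] by (simp add: stabilizer_def Sym_mult del: atLeastAtMost_iff)

lemma stabilizer_inverse:
  assumes "g \<in> stabilizer n f"
  shows "inverse g \<in> stabilizer n f"
proof -
  have g: "g \<in> Sym n" using assms by (simp add: stabilizer_def)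
  have "f (inverse g \<langle>$\<rangle> m) = f m" if "m \<in> {1..n}" for m
  proof -
    have "inverse g \<langle>$\<rangle> m \<in> {1..n}"
      using that g by (simp only: Sym_apply_in[OF Sym_inverse[OF g]])
    then have "f (g \<langle>$\<rangle> (inverse g \<langle>$\<rangle> m)) = f (inverse g \<langle>$\<rangle> m)"
      using assms unfolding stabilizer_def by blast
    then show ?thesis by simp
  qed
  then show ?thesis using g by (simp add: stabilizer_def)
qed

lemma swap_in_stabilizer:
  assumes "i \<in> {1..n}" "j \<in> {1..n}" "f i = f j"
  shows "\<langle>i \<leftrightarrow> j\<rangle> \<in> stabilizer n f"
proof -
  have "f (\<langle>i \<leftrightarrow> j\<rangle> \<langle>$\<rangle> m) = f m" for m
    using assms(3) by (cases "m = i"; cases "m = j") auto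
  then show ?thesis
    using Sym_swap[OF assms(1,2)] by (simp add: stabilizer_def)
qed

lemma cell_stabilizer_eq:
  assumes \<mu>: "\<mu> \<in> partitions_of n"
    and f: "\<And>c. c \<in> cells \<mu> \<Longrightarrow> f (tableau \<mu> c) = F c"
  shows "{g \<in> Sym n. \<forall>c\<in>cells \<mu>. \<exists>d\<in>cells \<mu>. F d = F c \<and>
    g \<langle>$\<rangle> (tableau \<mu> c) = tableau \<mu> d} = stabilizer n f"
proof -
  have "(\<forall>c\<in>cells \<mu>. \<exists>d\<in>cells \<mu>. F d = F c \<and> g \<langle>$\<rangle> (tableau \<mu> c) = tableau \<mu> d) \<longleftrightarrow>
      (\<forall>m\<in>{1..n}. f (g \<langle>$\<rangle> m) = f m)" if g: "g \<in> Sym n" for g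
  proof (intro iffI ballI)
    fix m assume *: "\<forall>c\<in>cells \<mu>. \<exists>d\<in>cells \<mu>. F d = F c \<and> g \<langle>$\<rangle> (tableau \<mu> c) = tableau \<mu> d"
      and "m \<in> {1..n}"
    then obtain c where c: "c \<in> cells \<mu>" "m = tableau \<mu> c" using ex_cell[OF \<mu>] by blast
    with * obtain d where "d \<in> cells \<mu>" "F d = F c" "g \<langle>$\<rangle> (tableau \<mu> c) = tableau \<mu> d" by blast
    with c show "f (g \<langle>$\<rangle> m) = f m" by (simp add: f)
  next
    fix c assume *: "\<forall>m\<in>{1..n}. f (g \<langle>$\<rangle> m) = f m" and c: "c \<in> cells \<mu>"
    have "g \<langle>$\<rangle> (tableau \<mu> c) \<in> {1..n}"
      using tableau_in[OF \<mu> c] by (simp only: Sym_apply_in[OF g])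
    then obtain d where "d \<in> cells \<mu>" "g \<langle>$\<rangle> (tableau \<mu> c) = tableau \<mu> d"
      using ex_cell[OF \<mu>] by blast
    then show "\<exists>d\<in>cells \<mu>. F d = F c \<and> g \<langle>$\<rangle> (tableau \<mu> c) = tableau \<mu> d"
      using *[rule_format, OF tableau_in[OF \<mu> c]] c by (auto simp: f)
  qed
  then show ?thesis
    unfolding stabilizer_def by blast
qed

lemma row_group_eq_stabilizer:
  assumes "\<mu> \<in> partitions_of n"
  shows "row_group \<mu> = stabilizer n (row_of \<mu>)"
  unfolding row_group_def partitions_ofD(3)[OF assms]
  by (rule cell_stabilizer_eq[OF assms]) simp

lemma column_group_eq_stabilizer:
  assumes "\<mu> \<in> partitions_of n"
  shows "column_group \<mu> = stabilizer n (col_of \<mu>)"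
  unfolding column_group_def partitions_ofD(3)[OF assms]
  by (rule cell_stabilizer_eq[OF assms]) simp

lemma young_symmetrizer_eq:
  assumes "\<mu> \<in> partitions_of n"
  shows "young_symmetrizer \<mu> = sym_sum n (row_of \<mu>) * alt_sum n (col_of \<mu>)"
  by (simp add: young_symmetrizer_def sym_sum_def alt_sum_def perm_sign_def
      row_group_eq_stabilizer[OF assms] column_group_eq_stabilizer[OF assms])

lemma permutation_apply: "permutation (apply g)"
  using "apply"[of g] by (simp add: permutation)

lemma perm_sign_mult: "perm_sign (g * h) = perm_sign g * perm_sign h"
  by (simp add: perm_sign_def apply_times sign_compose permutation_apply)

lemma perm_sign_one [simp]: "perm_sign 1 = 1"
  by (simp add: perm_sign_def)

lemma perm_sign_swap: "i \<noteq> j \<Longrightarrow> perm_sign \<langle>i \<leftrightarrow> j\<rangle> = -1"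
  by (simp add: perm_sign_def swap.rep_eq sign_swap_id)

lemma perm_sign_square: "perm_sign g * perm_sign g = 1"
  by (simp add: perm_sign_def flip: of_int_mult)

lemma stabilizer_mult_iff:
  assumes "h \<in> stabilizer n f"
  shows "h * g \<in> stabilizer n f \<longleftrightarrow> g \<in> stabilizer n f" "g * h \<in> stabilizer n f \<longleftrightarrow> g \<in> stabilizer n f"
proof -
  have "g = inverse h * (h * g)" "g = (g * h) * inverse h"
    by (simp_all add: mult.assoc) (simp flip: mult.assoc)
  then show "h * g \<in> stabilizer n f \<longleftrightarrow> g \<in> stabilizer n f"
    "g * h \<in> stabilizer n f \<longleftrightarrow> g \<in> stabilizer n f"
    using assms stabilizer_mult stabilizer_inverse by metis+
qed

lemma ga_coeff_sym_sum: "ga_coeff (sym_sum n f) g = (if g \<in> stabilizer n f then 1 else 0)"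
  by (simp add: sym_sum_def lookup_sum ga_coeff_of_perm)

lemma ga_coeff_alt_sum: "ga_coeff (alt_sum n f) g = (if g \<in> stabilizer n f then perm_sign g else 0)"
  by (simp add: alt_sum_def lookup_sum ga_coeff_of_perm if_distrib[of "\<lambda>x. _ * x"] cong: if_cong)

lemma sym_sum_absorb:
  assumes "h \<in> stabilizer n f"
  shows "of_perm h * sym_sum n f = sym_sum n f" "sym_sum n f * of_perm h = sym_sum n f"
  by (rule poly_mapping_eqI, simp add: ga_coeff_sym_sum ga_coeff_of_perm_mult ga_coeff_mult_of_perm
      stabilizer_mult_iff[OF stabilizer_inverse[OF assms]])+

lemma perm_sign_inverse [simp]: "perm_sign (inverse g) = perm_sign g"
  by (metis mult.assoc mult.right_neutral perm.right_inverse perm_sign_mult perm_sign_one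
      perm_sign_square mult.left_neutral)

lemma alt_sum_absorb:
  assumes "h \<in> stabilizer n f"
  shows "of_perm h * alt_sum n f = ga_scale (perm_sign h) (alt_sum n f)"
    "alt_sum n f * of_perm h = ga_scale (perm_sign h) (alt_sum n f)"
  by (rule poly_mapping_eqI, simp add: ga_coeff_alt_sum ga_coeff_of_perm_mult ga_coeff_mult_of_perm
      stabilizer_mult_iff[OF stabilizer_inverse[OF assms]] perm_sign_mult mult.commute)+

lemma sym_sum_in [intro]: "sym_sum n f \<in> Sym_algebra n"
  unfolding sym_sum_def using stabilizer_subset_Sym[of n f] by (auto intro!: Sym_algebra_sum)

lemma alt_sum_in [intro]: "alt_sum n f \<in> Sym_algebra n"
  unfolding alt_sum_def using stabilizer_subset_Sym[of n f] by (auto intro!: Sym_algebra_sum)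

lemma ga_eq_uminusD:
  fixes x :: "'a::field_char_0 group_algebra"
  assumes "x = - x"
  shows "x = 0"
proof (rule poly_mapping_eqI)
  fix k
  have "ga_coeff x k = - ga_coeff x k"
    by (metis assms lookup_uminus)
  then have "2 * ga_coeff x k = 0" by (simp add: eq_neg_iff_add_eq_0)
  then show "ga_coeff x k = ga_coeff 0 k" by simp
qed

text \<open>
  The transposition of a colliding pair of entries can be moved past \<open>g\<close>. It is absorbed with sign 1
  on one side and with sign -1 on the other.
\<close>

lemma sym_alt_eq_0:
  fixes g :: "nat perm"
  assumes "i \<in> {1..n}" "j \<in> {1..n}" "i \<noteq> j" "g \<in> Sym n"
    and "f (g \<langle>$\<rangle> i) = f (g \<langle>$\<rangle> j)" "f' i = f' j"
  shows "sym_sum n f * of_perm g * alt_sum n f' = (0 :: 'a::field_char_0 group_algebra)"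
    and "alt_sum n f * of_perm g * sym_sum n f' = (0 :: 'a group_algebra)"
proof -
  let ?t = "\<langle>i \<leftrightarrow> j\<rangle>" and ?t' = "\<langle>g \<langle>$\<rangle> i \<leftrightarrow> g \<langle>$\<rangle> j\<rangle>"
  have t: "?t \<in> stabilizer n f'"
    using assms by (intro swap_in_stabilizer) auto
  have t': "?t' \<in> stabilizer n f"
    using assms(1,2,5) by (intro swap_in_stabilizer) (simp_all only: Sym_apply_in[OF assms(4)])
  have move: "of_perm ?t' * of_perm g = (of_perm g * of_perm ?t :: 'a group_algebra)"
    by (simp add: swap_conj flip: of_perm_mult)
  have s: "perm_sign ?t = (-1 :: 'a)" "perm_sign ?t' = (-1 :: 'a)"
    using assms(3) by (simp_all add: perm_sign_swap apply_inj)
  have "sym_sum n f * of_perm g * alt_sum n f' =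
      sym_sum n f * of_perm ?t' * of_perm g * (alt_sum n f' :: 'a group_algebra)"
    by (simp add: sym_sum_absorb[OF t'])
  also have "\<dots> = sym_sum n f * of_perm g * (of_perm ?t * alt_sum n f')"
    by (simp add: mult.assoc move flip: mult.assoc[of "of_perm ?t'"])
  also have "\<dots> = - (sym_sum n f * of_perm g * alt_sum n f')"
    by (simp add: alt_sum_absorb[OF t] s ga_scale_mult_right)
  finally show "sym_sum n f * of_perm g * alt_sum n f' = (0 :: 'a group_algebra)"
    by (rule ga_eq_uminusD)
  have "alt_sum n f * of_perm g * sym_sum n f' =
      - (alt_sum n f * of_perm ?t' * of_perm g * (sym_sum n f' :: 'a group_algebra))"
    by (simp add: alt_sum_absorb[OF t'] s ga_scale_mult_left)
  also have "\<dots> = - (alt_sum n f * of_perm g * (of_perm ?t * sym_sum n f'))"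
    by (simp add: mult.assoc move flip: mult.assoc[of "of_perm ?t'"])
  also have "\<dots> = - (alt_sum n f * of_perm g * sym_sum n f')"
    by (simp add: sym_sum_absorb[OF t])
  finally show "alt_sum n f * of_perm g * sym_sum n f' = (0 :: 'a group_algebra)"
    by (rule ga_eq_uminusD)
qed


section \<open>Collisions of tableaux and the dominance order\<close>

lemma down_closed_eq_lessThan:
  fixes A :: "nat set"
  assumes "finite A" "\<And>i k. k \<in> A \<Longrightarrow> i < k \<Longrightarrow> i \<in> A"
  shows "A = {..<card A}"
proof (cases "A = {}")
  case False
  have "A = {..Max A}"
  proof (intro equalityI subsetI)
    fix i assume "i \<in> {..Max A}"
    then show "i \<in> A"
      using assms(2)[of "Max A" i] Max_in[OF assms(1) False] by (cases "i = Max A") auto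
  qed (use assms(1) in auto)
  then show ?thesis
    by (metis card_atMost lessThan_Suc_atMost)
qed simp

lemma card_fibres:
  assumes "finite A" "finite J" "h ` A \<subseteq> J"
  shows "card A = (\<Sum>j\<in>J. card {x \<in> A. h x = j})"
  using sum.group[OF assms, of "\<lambda>_. 1 :: nat"] by simp

lemma partition_antimono:
  assumes "\<mu> \<in> partitions_of n" "i \<le> i'" "i' < length \<mu>"
  shows "\<mu> ! i' \<le> \<mu> ! i"
  using partitions_ofD(1)[OF assms(1)] assms(2,3)
  by (cases "i = i'") (auto simp: sorted_wrt_iff_nth_less)

text \<open>
  The sum of the first \<open>k\<close> parts. The dominance order compares these numbers for all \<open>k\<close>.
\<close>

definition rows_above :: "nat list \<Rightarrow> nat \<Rightarrow> nat" where
  "rows_above \<mu> k = card {c \<in> cells \<mu>. fst c < k}"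

lemma rows_above_Suc:
  "rows_above \<mu> (Suc k) = rows_above \<mu> k + (if k < length \<mu> then \<mu> ! k else 0)"
proof -
  have "{c \<in> cells \<mu>. fst c < Suc k} =
      {c \<in> cells \<mu>. fst c < k} \<union> {c \<in> cells \<mu>. fst c = k}"
    by auto
  moreover have "{c \<in> cells \<mu>. fst c < k} \<inter> {c \<in> cells \<mu>. fst c = k} = {}" by auto
  moreover have "{c \<in> cells \<mu>. fst c = k} = (if k < length \<mu> then {k} \<times> {..<\<mu> ! k} else {})"
    by (auto simp: cells_def)
  then have "card {c \<in> cells \<mu>. fst c = k} = (if k < length \<mu> then \<mu> ! k else 0)"
    by simp
  ultimately show ?thesis
    by (simp add: rows_above_def card_Un_disjoint)
qed

lemma rows_above_inject:
  assumes "\<mu> \<in> partitions_of n" "\<nu> \<in> partitions_of n'" "rows_above \<mu> = rows_above \<nu>"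
  shows "\<mu> = \<nu>"
proof -
  have *: "(if k < length \<mu> then \<mu> ! k else 0) = (if k < length \<nu> then \<nu> ! k else 0)" for k
    using rows_above_Suc[of \<mu> k] rows_above_Suc[of \<nu> k] assms(3) by simp
  have pos: "0 < \<mu> ! k" if "k < length \<mu>" for k
    using that partitions_ofD(2)[OF assms(1)] by (metis gr0I nth_mem)
  have pos': "0 < \<nu> ! k" if "k < length \<nu>" for k
    using that partitions_ofD(2)[OF assms(2)] by (metis gr0I nth_mem)
  have iff: "k < length \<mu> \<longleftrightarrow> k < length \<nu>" for k
    using *[of k] pos[of k] pos'[of k] by (auto split: if_splits)
  have "length \<mu> = length \<nu>"
    using iff[of "length \<mu>"] iff[of "length \<nu>"] by simp
  then show ?thesis
  proof (rule nth_equalityI)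
    fix k assume "k < length \<mu>"
    then show "\<mu> ! k = \<nu> ! k" using *[of k] iff[of k] by simp
  qed
qed

text \<open>A part of the conjugate partition.\<close>

definition column_height :: "nat list \<Rightarrow> nat \<Rightarrow> nat" where
  "column_height \<mu> j = card {i. i < length \<mu> \<and> j < \<mu> ! i}"

lemma cells_iff_column_height:
  assumes "\<mu> \<in> partitions_of n"
  shows "(i, j) \<in> cells \<mu> \<longleftrightarrow> i < column_height \<mu> j"
proof -
  have "{i. i < length \<mu> \<and> j < \<mu> ! i} = {..<column_height \<mu> j}"
    unfolding column_height_def
    by (rule down_closed_eq_lessThan)
       (auto intro: order.strict_trans2[OF _ partition_antimono[OF assms]])
  then show ?thesis
    by (auto simp: cells_def)
qed

lemma card_column_above:
  assumes "\<mu> \<in> partitions_of n"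
  shows "card {c \<in> cells \<mu>. fst c < k \<and> snd c = j} = min (column_height \<mu> j) k"
proof -
  have "{c \<in> cells \<mu>. fst c < k \<and> snd c = j} = {..<min (column_height \<mu> j) k} \<times> {j}"
    using cells_iff_column_height[OF assms] by auto
  then show ?thesis by simp
qed

lemma card_column:
  assumes "\<mu> \<in> partitions_of n"
  shows "card {x \<in> {1..n}. col_of \<mu> x = j} = column_height \<mu> j"
proof -
  have "card {x \<in> {1..n}. col_of \<mu> x = j} = card {c \<in> cells \<mu>. snd c = j}"
    by (rule card_coordinates[OF assms])
  also have "{c \<in> cells \<mu>. snd c = j} = {..<column_height \<mu> j} \<times> {j}"
    using cells_iff_column_height[OF assms] by auto
  finally show ?thesis by simp
qed

lemma card_column_fibre_le:
  assumes "\<mu> \<in> partitions_of n" "inj_on (\<lambda>x. (p x, col_of \<mu> x)) {1..n}"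
  shows "card {x \<in> {1..n}. p x < k \<and> col_of \<mu> x = j} \<le> min (column_height \<mu> j) k"
proof -
  have "card {x \<in> {1..n}. p x < k \<and> col_of \<mu> x = j} \<le> card {x \<in> {1..n}. col_of \<mu> x = j}"
    by (rule card_mono) auto
  moreover have "card {x \<in> {1..n}. p x < k \<and> col_of \<mu> x = j} \<le> card {..<k}"
  proof (rule card_inj_on_le[of p])
    show "inj_on p {x \<in> {1..n}. p x < k \<and> col_of \<mu> x = j}"
    proof (rule inj_onI)
      fix x y assume "x \<in> {x \<in> {1..n}. p x < k \<and> col_of \<mu> x = j}"
        "y \<in> {x \<in> {1..n}. p x < k \<and> col_of \<mu> x = j}" "p x = p y"
      then show "x = y" by (intro inj_onD[OF assms(2)]) simp_all
    qed
  qed auto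
  ultimately show ?thesis
    using card_column[OF assms(1), of j] by simp
qed

lemma rows_above_eq_card:
  assumes \<mu>: "\<mu> \<in> partitions_of n" and g: "g \<in> Sym n"
  shows "rows_above \<mu> k = card {x \<in> {1..n}. row_of \<mu> (g \<langle>$\<rangle> x) < k}"
proof -
  have "bij_betw (apply g) {x \<in> {1..n}. row_of \<mu> (g \<langle>$\<rangle> x) < k} {x \<in> {1..n}. row_of \<mu> x < k}"
  proof (rule bij_betw_byWitness[of _ "apply (inverse g)"])
    show "apply g ` {x \<in> {1..n}. row_of \<mu> (g \<langle>$\<rangle> x) < k} \<subseteq> {x \<in> {1..n}. row_of \<mu> x < k}"
      using Sym_apply_in[OF g] by blast
    have "\<And>m. inverse g \<langle>$\<rangle> m \<in> {1..n} \<longleftrightarrow> m \<in> {1..n}"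
      using g by (intro Sym_apply_in) auto
    then show "apply (inverse g) ` {x \<in> {1..n}. row_of \<mu> x < k} \<subseteq> {x \<in> {1..n}. row_of \<mu> (g \<langle>$\<rangle> x) < k}"
      by (auto simp del: atLeastAtMost_iff)
  qed auto
  then have "card {x \<in> {1..n}. row_of \<mu> (g \<langle>$\<rangle> x) < k} = card {x \<in> {1..n}. row_of \<mu> x < k}"
    by (rule bij_betw_same_card)
  also have "\<dots> = rows_above \<mu> k"
    unfolding rows_above_def by (rule card_coordinates[OF \<mu>])
  finally show ?thesis by simp
qed

lemma col_of_in:
  assumes "\<nu> \<in> partitions_of n" "x \<in> {1..n}"
  shows "col_of \<nu> x \<in> snd ` cells \<nu>"
  using coordinates_in_cells[OF assms] by (rule rev_image_eqI) simp

lemma card_rows_above_split: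
  assumes \<nu>: "\<nu> \<in> partitions_of n"
  shows "card {x \<in> {1..n}. p x < k} =
    (\<Sum>j\<in>snd ` cells \<nu>. card {x \<in> {1..n}. p x < k \<and> col_of \<nu> x = j})"
proof -
  have "card {x \<in> {1..n}. p x < k} =
      (\<Sum>j\<in>snd ` cells \<nu>. card {x \<in> {x \<in> {1..n}. p x < k}. col_of \<nu> x = j})"
    using col_of_in[OF \<nu>] by (intro card_fibres image_subsetI) (simp_all del: atLeastAtMost_iff)
  then show ?thesis by (simp add: conj_assoc)
qed

lemma rows_above_split:
  assumes \<nu>: "\<nu> \<in> partitions_of n"
  shows "rows_above \<nu> k = (\<Sum>j\<in>snd ` cells \<nu>. min (column_height \<nu> j) k)"
proof -
  have "rows_above \<nu> k = (\<Sum>j\<in>snd ` cells \<nu>. card {c \<in> {c \<in> cells \<nu>. fst c < k}. snd c = j})"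
    unfolding rows_above_def by (intro card_fibres) auto
  then show ?thesis by (simp add: conj_assoc card_column_above[OF \<nu>])
qed

text \<open>
  Injectivity means that no two entries \<open>x\<close> share the column in the tableau of \<open>\<nu>\<close> while their images
  share the row in the tableau of \<open>\<mu>\<close>. So the first \<open>k\<close> rows of \<open>\<mu>\<close> take from each column of
  \<open>\<nu>\<close> at most what the first \<open>k\<close> rows of \<open>\<nu>\<close> take, namely \<open>k\<close> entries or the whole column.
\<close>

lemma collision_free_dominated:
  assumes \<mu>: "\<mu> \<in> partitions_of n" and \<nu>: "\<nu> \<in> partitions_of n" and g: "g \<in> Sym n"
    and "inj_on (\<lambda>x. (row_of \<mu> (g \<langle>$\<rangle> x), col_of \<nu> x)) {1..n}"
  shows "rows_above \<mu> k \<le> rows_above \<nu> k"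
proof -
  have "rows_above \<mu> k = (\<Sum>j\<in>snd ` cells \<nu>.
      card {x \<in> {1..n}. row_of \<mu> (g \<langle>$\<rangle> x) < k \<and> col_of \<nu> x = j})"
    by (rule trans[OF rows_above_eq_card[OF \<mu> g] card_rows_above_split[OF \<nu>]])
  also have "\<dots> \<le> (\<Sum>j\<in>snd ` cells \<nu>. min (column_height \<nu> j) k)"
    by (intro sum_mono card_column_fibre_le[OF \<nu> assms(4)])
  also have "\<dots> = rows_above \<nu> k"
    by (rule rows_above_split[OF \<nu>, symmetric])
  finally show ?thesis .
qed

text \<open>
  For tableaux of the same shape all the inequalities behind \<open>collision_free_dominated\<close> are equalities,
  so that pairing the row of \<open>g x\<close> with the column of \<open>x\<close> is a bijection onto the diagram. The
  permutation that it defines is the column part of \<open>g\<close>.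
\<close>

lemma collision_free_factor:
  assumes \<mu>: "\<mu> \<in> partitions_of n" and g: "g \<in> Sym n"
    and inj: "inj_on (\<lambda>x. (row_of \<mu> (g \<langle>$\<rangle> x), col_of \<mu> x)) {1..n}"
  obtains u v where "u \<in> stabilizer n (row_of \<mu>)" "v \<in> stabilizer n (col_of \<mu>)" "g = u * v"
proof -
  define p where "p x = row_of \<mu> (g \<langle>$\<rangle> x)" for x
  have inj': "inj_on (\<lambda>x. (p x, col_of \<mu> x)) {1..n}"
    using inj by (simp add: p_def)
  have eq: "card {x \<in> {1..n}. p x < k \<and> col_of \<mu> x = j} = min (column_height \<mu> j) k"
    if "j \<in> snd ` cells \<mu>" for j k
  proof -
    have "(\<Sum>j\<in>snd ` cells \<mu>. card {x \<in> {1..n}. p x < k \<and> col_of \<mu> x = j}) =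
        (\<Sum>j\<in>snd ` cells \<mu>. min (column_height \<mu> j) k)"
      using rows_above_eq_card[OF \<mu> g, of k] card_rows_above_split[OF \<mu>, of p k]
        rows_above_split[OF \<mu>, of k] by (simp add: p_def)
    then show ?thesis
      by (rule sum_mono_inv) (use that card_column_fibre_le[OF \<mu> inj'] in simp_all)
  qed
  have in_cells: "(p x, col_of \<mu> x) \<in> cells \<mu>" if "x \<in> {1..n}" for x
  proof -
    define j where "j = col_of \<mu> x"
    have j: "j \<in> snd ` cells \<mu>"
      unfolding j_def by (rule col_of_in[OF \<mu> that])
    \<comment> \<open>all entries of the column \<open>j\<close> have their images in rows with index below the column height\<close>
    have "card {x \<in> {1..n}. p x < column_height \<mu> j \<and> col_of \<mu> x = j} =
        card {x \<in> {1..n}. col_of \<mu> x = j}"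
      by (simp only: eq[OF j] card_column[OF \<mu>] min.idem)
    then have "{x \<in> {1..n}. p x < column_height \<mu> j \<and> col_of \<mu> x = j} = {x \<in> {1..n}. col_of \<mu> x = j}"
      by (intro card_subset_eq) auto
    moreover have "x \<in> {x \<in> {1..n}. col_of \<mu> x = j}"
      using that by (simp add: j_def)
    ultimately have "x \<in> {x \<in> {1..n}. p x < column_height \<mu> j \<and> col_of \<mu> x = j}"
      by (simp only:)
    then have "p x < column_height \<mu> j" by simp
    then show ?thesis
      by (simp add: cells_iff_column_height[OF \<mu>] j_def)
  qed
  have "inj_on (tableau \<mu>) ((\<lambda>x. (p x, col_of \<mu> x)) ` {1..n})"
    by (rule inj_on_subset[OF inj_on_tableau]) (rule image_subsetI, rule in_cells)
  from comp_inj_on[OF inj' this]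
  have "inj_on (\<lambda>x. tableau \<mu> (p x, col_of \<mu> x)) {1..n}"
    by (simp add: comp_def)
  moreover have "(\<lambda>x. tableau \<mu> (p x, col_of \<mu> x)) ` {1..n} \<subseteq> {1..n}"
    by (rule image_subsetI, rule tableau_in[OF \<mu> in_cells])
  ultimately have "bij_betw (\<lambda>x. tableau \<mu> (p x, col_of \<mu> x)) {1..n} {1..n}"
    by (simp add: bij_betw_def endo_inj_surj)
  from Sym_of_bij[OF this] obtain v where v: "v \<in> Sym n"
    "\<And>x. x \<in> {1..n} \<Longrightarrow> v \<langle>$\<rangle> x = tableau \<mu> (p x, col_of \<mu> x)"
    by blast
  have "v \<in> stabilizer n (col_of \<mu>)"
    using v in_cells by (simp add: stabilizer_def)
  moreover have "g * inverse v \<in> stabilizer n (row_of \<mu>)"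
  proof -
    have "row_of \<mu> ((g * inverse v) \<langle>$\<rangle> m) = row_of \<mu> m" if "m \<in> {1..n}" for m
    proof -
      define x where "x = inverse v \<langle>$\<rangle> m"
      have x: "x \<in> {1..n}"
        unfolding x_def using that v(1) by (simp only: Sym_apply_in[OF Sym_inverse[OF v(1)]])
      have "row_of \<mu> m = row_of \<mu> (v \<langle>$\<rangle> x)" by (simp add: x_def)
      also have "\<dots> = p x" by (simp only: v(2)[OF x] row_of_tableau[OF in_cells[OF x]] fst_conv)
      finally show ?thesis by (simp add: p_def x_def)
    qed
    then show ?thesis using g v(1) by (auto simp: stabilizer_def)
  qed
  moreover have "g = (g * inverse v) * v"
    by (simp add: mult.assoc)
  ultimately show ?thesis using that by blast
qed


section \<open>Products of Young symmetrizers\<close>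

lemma ga_sandwich_expand:
  assumes "x \<in> Sym_algebra n"
  shows "a * x * b = (\<Sum>g\<in>Sym n. ga_scale (ga_coeff x g) (a * of_perm g * b))"
  by (subst Sym_algebra_expand[OF assms])
     (simp add: sum_distrib_left sum_distrib_right ga_scale_mult_left ga_scale_mult_right)

lemma ga_sandwich_nonzero:
  assumes "x \<in> Sym_algebra n" "a * x * b \<noteq> 0"
  obtains g where "g \<in> Sym n" "a * of_perm g * b \<noteq> 0"
proof (rule ccontr)
  assume "\<not> thesis"
  then have "a * of_perm g * b = 0" if "g \<in> Sym n" for g
    using that \<open>\<And>g. g \<in> Sym n \<Longrightarrow> a * of_perm g * b \<noteq> 0 \<Longrightarrow> thesis\<close> by blast
  with assms show False
    by (simp add: ga_sandwich_expand)
qed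

lemma sym_alt_dominated:
  fixes x :: "'a::field_char_0 group_algebra"
  assumes \<mu>: "\<mu> \<in> partitions_of n" and \<nu>: "\<nu> \<in> partitions_of n" and x: "x \<in> Sym_algebra n"
    and "sym_sum n (row_of \<mu>) * x * alt_sum n (col_of \<nu>) \<noteq> 0"
  shows "rows_above \<mu> k \<le> rows_above \<nu> k"
proof -
  obtain g where g: "g \<in> Sym n"
    and ne: "sym_sum n (row_of \<mu>) * of_perm g * alt_sum n (col_of \<nu>) \<noteq> (0 :: 'a group_algebra)"
    by (rule ga_sandwich_nonzero[OF x assms(4)])
  have "inj_on (\<lambda>x. (row_of \<mu> (g \<langle>$\<rangle> x), col_of \<nu> x)) {1..n}"
  proof (rule inj_onI, rule ccontr)
    fix i j assume ij: "i \<in> {1..n}" "j \<in> {1..n}" "i \<noteq> j"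
      "(row_of \<mu> (g \<langle>$\<rangle> i), col_of \<nu> i) = (row_of \<mu> (g \<langle>$\<rangle> j), col_of \<nu> j)"
    have "sym_sum n (row_of \<mu>) * of_perm g * alt_sum n (col_of \<nu>) = (0 :: 'a group_algebra)"
      by (rule sym_alt_eq_0(1)[OF ij(1-3) g]) (use ij(4) in simp_all)
    with ne show False by simp
  qed
  then show ?thesis
    by (rule collision_free_dominated[OF \<mu> \<nu> g])
qed

lemma alt_sym_dominated:
  fixes x :: "'a::field_char_0 group_algebra"
  assumes \<mu>: "\<mu> \<in> partitions_of n" and \<nu>: "\<nu> \<in> partitions_of n" and x: "x \<in> Sym_algebra n"
    and "alt_sum n (col_of \<mu>) * x * sym_sum n (row_of \<nu>) \<noteq> 0"
  shows "rows_above \<nu> k \<le> rows_above \<mu> k"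
proof -
  obtain g where g: "g \<in> Sym n"
    and ne: "alt_sum n (col_of \<mu>) * of_perm g * sym_sum n (row_of \<nu>) \<noteq> (0 :: 'a group_algebra)"
    by (rule ga_sandwich_nonzero[OF x assms(4)])
  \<comment> \<open>in terms of the images under \<open>g\<close>, a collision is one for \<open>\<nu>\<close>, \<open>\<mu>\<close> and the inverse of \<open>g\<close>\<close>
  let ?h = "inverse g"
  have h: "?h \<in> Sym n" using g by blast
  have "inj_on (\<lambda>x. (row_of \<nu> (?h \<langle>$\<rangle> x), col_of \<mu> x)) {1..n}"
  proof (rule inj_onI, rule ccontr)
    fix i j assume ij: "i \<in> {1..n}" "j \<in> {1..n}" "i \<noteq> j"
      "(row_of \<nu> (?h \<langle>$\<rangle> i), col_of \<mu> i) = (row_of \<nu> (?h \<langle>$\<rangle> j), col_of \<mu> j)"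
    have "alt_sum n (col_of \<mu>) * of_perm g * sym_sum n (row_of \<nu>) = (0 :: 'a group_algebra)"
      by (rule sym_alt_eq_0(2)[of "?h \<langle>$\<rangle> i" _ "?h \<langle>$\<rangle> j"], unfold Sym_apply_in[OF h])
         (use ij g in \<open>auto simp: apply_inj\<close>)
    with ne show False by simp
  qed
  then show ?thesis
    by (rule collision_free_dominated[OF \<nu> \<mu> h])
qed

lemma young_symmetrizer_in:
  assumes "\<mu> \<in> partitions_of n"
  shows "young_symmetrizer \<mu> \<in> Sym_algebra n"
  unfolding young_symmetrizer_eq[OF assms] by blast

text \<open>
  The product contains a row symmetrizer of \<open>\<mu>\<close> before a column antisymmetrizer of \<open>\<nu>\<close>, and a column
  antisymmetrizer of \<open>\<mu>\<close> before a row symmetrizer of \<open>\<nu>\<close>. If it were not 0, each partition would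
  dominate the other.
\<close>

lemma young_symmetrizer_orthogonal:
  fixes x :: "'a::field_char_0 group_algebra"
  assumes \<mu>: "\<mu> \<in> partitions_of n" and \<nu>: "\<nu> \<in> partitions_of n" and x: "x \<in> Sym_algebra n"
    and "\<mu> \<noteq> \<nu>"
  shows "young_symmetrizer \<mu> * x * young_symmetrizer \<nu> = 0"
proof (rule ccontr)
  assume *: "young_symmetrizer \<mu> * x * young_symmetrizer \<nu> \<noteq> 0"
  let ?y = "alt_sum n (col_of \<mu>) * x * sym_sum n (row_of \<nu>)"
  have eq: "young_symmetrizer \<mu> * x * young_symmetrizer \<nu> =
      sym_sum n (row_of \<mu>) * ?y * alt_sum n (col_of \<nu>)"
    by (simp add: young_symmetrizer_eq[OF \<mu>] young_symmetrizer_eq[OF \<nu>] mult.assoc)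
  have y: "?y \<in> Sym_algebra n" using x by blast
  have "rows_above \<mu> k \<le> rows_above \<nu> k" for k
    by (rule sym_alt_dominated[OF \<mu> \<nu> y]) (use * eq in simp)
  moreover have "?y \<noteq> 0" using * eq by auto
  then have "rows_above \<nu> k \<le> rows_above \<mu> k" for k
    by (rule alt_sym_dominated[OF \<mu> \<nu> x])
  ultimately have "rows_above \<mu> = rows_above \<nu>"
    by (intro ext order.antisym)
  then show False
    using rows_above_inject[OF \<mu> \<nu>] assms(4) by simp
qed

text \<open>
  A permutation either has a collision and contributes 0, or is absorbed by the two sums after it has
  been factored into a row and a column part.
\<close>

lemma sym_alt_multiple:
  fixes x :: "'a::field_char_0 group_algebra"
  assumes \<mu>: "\<mu> \<in> partitions_of n" and x: "x \<in> Sym_algebra n"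
  obtains c where "sym_sum n (row_of \<mu>) * x * alt_sum n (col_of \<mu>) = ga_scale c (young_symmetrizer \<mu>)"
proof -
  have "\<exists>c. sym_sum n (row_of \<mu>) * of_perm g * alt_sum n (col_of \<mu>) =
      ga_scale c (young_symmetrizer \<mu> :: 'a group_algebra)" if g: "g \<in> Sym n" for g
  proof (cases "inj_on (\<lambda>x. (row_of \<mu> (g \<langle>$\<rangle> x), col_of \<mu> x)) {1..n}")
    case True
    then obtain u v where uv: "u \<in> stabilizer n (row_of \<mu>)" "v \<in> stabilizer n (col_of \<mu>)" "g = u * v"
      using collision_free_factor[OF \<mu> g] by blast
    have "sym_sum n (row_of \<mu>) * of_perm g * alt_sum n (col_of \<mu>) =
        (sym_sum n (row_of \<mu>) * of_perm u) * (of_perm v * alt_sum n (col_of \<mu>) :: 'a group_algebra)"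
      by (simp add: uv(3) of_perm_mult mult.assoc)
    also have "\<dots> = ga_scale (perm_sign v) (young_symmetrizer \<mu>)"
      by (simp add: sym_sum_absorb(2)[OF uv(1)] alt_sum_absorb(1)[OF uv(2)] ga_scale_mult_right
          young_symmetrizer_eq[OF \<mu>])
    finally show ?thesis by blast
  next
    case False
    then obtain i j where "i \<in> {1..n}" "j \<in> {1..n}" "i \<noteq> j"
      "row_of \<mu> (g \<langle>$\<rangle> i) = row_of \<mu> (g \<langle>$\<rangle> j)" "col_of \<mu> i = col_of \<mu> j"
      unfolding inj_on_def by blast
    from sym_alt_eq_0(1)[OF this(1-3) g this(4-5)]
    have "sym_sum n (row_of \<mu>) * of_perm g * alt_sum n (col_of \<mu>) = (0 :: 'a group_algebra)" .
    then show ?thesis by (intro exI[of _ 0]) simp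
  qed
  then obtain c where "\<And>g. g \<in> Sym n \<Longrightarrow> sym_sum n (row_of \<mu>) * of_perm g * alt_sum n (col_of \<mu>) =
      ga_scale (c g) (young_symmetrizer \<mu> :: 'a group_algebra)"
    by metis
  then have "sym_sum n (row_of \<mu>) * x * alt_sum n (col_of \<mu>) =
      ga_scale (\<Sum>g\<in>Sym n. ga_coeff x g * c g) (young_symmetrizer \<mu>)"
    unfolding ga_sandwich_expand[OF x] by (simp add: ga.scale_sum_left)
  then show ?thesis by (rule that)
qed

lemma row_column_stabilizer_trivial:
  assumes \<mu>: "\<mu> \<in> partitions_of n" "g \<in> stabilizer n (row_of \<mu>)" "g \<in> stabilizer n (col_of \<mu>)"
  shows "g = 1"
proof (rule Sym_eqI)
  show g: "g \<in> Sym n" using assms by (simp add: stabilizer_def)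
  fix m assume m: "m \<in> {1..n}"
  then have gm: "g \<langle>$\<rangle> m \<in> {1..n}" by (simp only: Sym_apply_in[OF g])
  have "row_of \<mu> (g \<langle>$\<rangle> m) = row_of \<mu> m" "col_of \<mu> (g \<langle>$\<rangle> m) = col_of \<mu> m"
    using assms(2,3) m unfolding stabilizer_def by blast+
  then show "g \<langle>$\<rangle> m = 1 \<langle>$\<rangle> m"
    using tableau_coordinates[OF \<mu>(1) m] tableau_coordinates[OF \<mu>(1) gm] by simp
qed simp

lemma ga_coeff_young_symmetrizer_one:
  assumes \<mu>: "\<mu> \<in> partitions_of n"
  shows "ga_coeff (young_symmetrizer \<mu>) 1 = 1"
proof -
  let ?R = "stabilizer n (row_of \<mu>)" and ?C = "stabilizer n (col_of \<mu>)"
  have "ga_coeff (young_symmetrizer \<mu>) 1 =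
      (\<Sum>g\<in>?R. if inverse g \<in> ?C then perm_sign g else (0 :: 'a))"
    unfolding young_symmetrizer_eq[OF \<mu>] sym_sum_def
    by (simp add: sum_distrib_right lookup_sum ga_coeff_of_perm_mult ga_coeff_alt_sum cong: if_cong)
  also have "\<dots> = (\<Sum>g\<in>?R. if g = 1 then 1 else 0)"
  proof (rule sum.cong[OF refl])
    fix g assume "g \<in> ?R"
    have "g = 1" if "inverse g = 1"
      using that by (metis perm.inverse_inverse perm.inverse_neutral)
    with \<open>g \<in> ?R\<close> show "(if inverse g \<in> ?C then perm_sign g else (0 :: 'a)) = (if g = 1 then 1 else 0)"
      using row_column_stabilizer_trivial[OF \<mu> stabilizer_inverse, of g] by (auto simp: stabilizer_one)
  qed
  also have "\<dots> = 1" by (simp add: stabilizer_one)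
  finally show ?thesis .
qed

text \<open>
  The factor \<open>h\<close> in \<open>e\<^sup>2 = h e\<close> for the Young symmetrizer \<open>e\<close>, in which the identity has the
  coefficient 1. It is \<open>n!\<close> divided by the dimension of the irreducible module.
\<close>

definition young_norm :: "nat list \<Rightarrow> 'a::field" where
  "young_norm \<mu> = ga_coeff (young_symmetrizer \<mu> * young_symmetrizer \<mu>) 1"

lemma young_symmetrizer_sandwich:
  fixes x :: "'a::field_char_0 group_algebra"
  assumes \<mu>: "\<mu> \<in> partitions_of n" and x: "x \<in> Sym_algebra n"
  shows "young_symmetrizer \<mu> * x * young_symmetrizer \<mu> =
    ga_scale (ga_coeff (young_symmetrizer \<mu> * x * young_symmetrizer \<mu>) 1) (young_symmetrizer \<mu>)"
proof -
  let ?y = "alt_sum n (col_of \<mu>) * x * sym_sum n (row_of \<mu>)"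
  have y: "?y \<in> Sym_algebra n" using x by blast
  obtain c where c: "sym_sum n (row_of \<mu>) * ?y * alt_sum n (col_of \<mu>) = ga_scale c (young_symmetrizer \<mu>)"
    by (rule sym_alt_multiple[OF \<mu> y])
  have eq: "young_symmetrizer \<mu> * x * young_symmetrizer \<mu> = ga_scale c (young_symmetrizer \<mu>)"
    unfolding c[symmetric] by (simp add: young_symmetrizer_eq[OF \<mu>] mult.assoc)
  show ?thesis
    by (simp add: eq ga_coeff_young_symmetrizer_one[OF \<mu>])
qed

lemma young_symmetrizer_square:
  fixes \<mu> :: "nat list"
  assumes \<mu>: "\<mu> \<in> partitions_of n"
  shows "young_symmetrizer \<mu> * young_symmetrizer \<mu> =
    ga_scale (young_norm \<mu>) (young_symmetrizer \<mu> :: 'a::field_char_0 group_algebra)"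
  using young_symmetrizer_sandwich[OF \<mu> Sym_algebra_one] by (simp add: young_norm_def)


section \<open>Characters in terms of Young symmetrizers\<close>

text \<open>
  The basis has to be the one chosen in the definition of the trace, for which a choice exists and
  which is finite as a subset of a finite-dimensional space.
\<close>

lemma ex_finite_basis:
  assumes "ga.subspace W" "W \<subseteq> Sym_algebra n"
  obtains B where "B = (SOME B. ga.independent B \<and> ga.span B = W)"
    "ga.independent B" "ga.span B = W" "finite B" "B \<subseteq> W"
proof -
  define B where "B = (SOME B. ga.independent B \<and> ga.span B = W)"
  have "\<exists>B. ga.independent B \<and> ga.span B = W"
    using ga.basis_exists[of W] ga.span_subspace[OF _ _ assms(1)] by metis
  then have B: "ga.independent B \<and> ga.span B = W"
    unfolding B_def by (rule someI_ex)
  have "finite B"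
    using ga.independent_span_bound[of "of_perm ` Sym n" B] B assms(2) ga.span_superset[of B]
    by (auto simp: Sym_algebra_eq_span)
  with B show ?thesis
    using ga.span_superset[of B] by (intro that[OF B_def]) auto
qed

text \<open>
  An operator that maps the group algebra into the subspace \<open>W\<close> has the same trace on both. On the
  group algebra, the trace is a sum of diagonal coefficients. Expanding basis elements of \<open>W\<close> in
  permutations, and images of permutations in the basis, gives the same double sum for both.
\<close>

lemma trace_on_eq_sum_coeff:
  assumes W: "ga.subspace W" "W \<subseteq> Sym_algebra n"
    and into: "\<And>x. x \<in> Sym_algebra n \<Longrightarrow> a * x * c \<in> W"
  shows "trace_on W (\<lambda>x. a * x * c) = (\<Sum>g\<in>Sym n. ga_coeff (a * of_perm g * c) g)"
proof -
  obtain B where B: "B = (SOME B. ga.independent B \<and> ga.span B = W)"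
    "ga.independent B" "ga.span B = W" "finite B" "B \<subseteq> W"
    by (rule ex_finite_basis[OF W])
  let ?r = "ga.representation B"
  have Qg: "a * of_perm g * c \<in> ga.span B" if "g \<in> Sym n" for g
    using into[OF of_perm_in_Sym_algebra[OF that]] B(3) by simp
  have "trace_on W (\<lambda>x. a * x * c) = (\<Sum>b\<in>B. ?r (a * b * c) b)"
    by (simp add: trace_on_def Let_def flip: B(1))
  also have "\<dots> = (\<Sum>b\<in>B. \<Sum>g\<in>Sym n. ga_coeff b g * ?r (a * of_perm g * c) b)"
  proof (rule sum.cong[OF refl])
    fix b assume b: "b \<in> B"
    have "a * b * c = (\<Sum>g\<in>Sym n. ga_scale (ga_coeff b g) (a * of_perm g * c))"
      using b B(5) W(2) by (intro ga_sandwich_expand) blast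
    then show "?r (a * b * c) b = (\<Sum>g\<in>Sym n. ga_coeff b g * ?r (a * of_perm g * c) b)"
      using Qg by (simp add: ga.representation_sum[OF B(2)] ga.representation_scale[OF B(2)]
        ga.span_scale)
  qed
  also have "\<dots> = (\<Sum>g\<in>Sym n. \<Sum>b\<in>B. ga_coeff b g * ?r (a * of_perm g * c) b)"
    by (rule sum.swap)
  also have "\<dots> = (\<Sum>g\<in>Sym n. ga_coeff (a * of_perm g * c) g)"
  proof (rule sum.cong[OF refl])
    fix g assume "g \<in> Sym n"
    then have "a * of_perm g * c = (\<Sum>b\<in>B. ga_scale (?r (a * of_perm g * c) b) b)"
      by (intro ga.sum_representation_eq[symmetric] B(2,4) Qg order_refl)
    then have "ga_coeff (a * of_perm g * c) g =
        ga_coeff (\<Sum>b\<in>B. ga_scale (?r (a * of_perm g * c) b) b) g"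
      by (rule arg_cong)
    also have "\<dots> = (\<Sum>b\<in>B. ga_coeff b g * ?r (a * of_perm g * c) b)"
      by (simp only: lookup_sum ga_coeff_scale mult.commute)
    finally show "(\<Sum>b\<in>B. ga_coeff b g * ?r (a * of_perm g * c) b) = ga_coeff (a * of_perm g * c) g" ..
  qed
  finally show ?thesis .
qed

lemma trace_on_scale:
  assumes W: "ga.subspace W" "W \<subseteq> Sym_algebra n"
    and T: "\<And>x. x \<in> W \<Longrightarrow> T x = ga_scale c (T' x)" "\<And>x. x \<in> W \<Longrightarrow> T' x \<in> W"
  shows "trace_on W T = c * trace_on W T'"
proof -
  obtain B where B: "B = (SOME B. ga.independent B \<and> ga.span B = W)"
    "ga.independent B" "ga.span B = W" "finite B" "B \<subseteq> W"
    by (rule ex_finite_basis[OF W])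
  have "trace_on W T = (\<Sum>b\<in>B. ga.representation B (T b) b)"
    by (simp add: trace_on_def Let_def flip: B(1))
  also have "\<dots> = (\<Sum>b\<in>B. c * ga.representation B (T' b) b)"
  proof (rule sum.cong[OF refl])
    fix b assume "b \<in> B"
    then have "b \<in> W" using B(5) by blast
    then show "ga.representation B (T b) b = c * ga.representation B (T' b) b"
      using T(2)[of b] B(3) by (simp add: T(1) ga.representation_scale[OF B(2)])
  qed
  also have "\<dots> = c * trace_on W T'"
    by (simp add: trace_on_def Let_def sum_distrib_left flip: B(1))
  finally show ?thesis .
qed

text \<open>The central idempotent of the irreducible module, times the square of \<open>young_norm \<mu>\<close>.\<close>

definition central_symmetrizer :: "nat list \<Rightarrow> 'a::field group_algebra" where
  "central_symmetrizer \<mu> =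
    (\<Sum>k\<in>Sym (sum_list \<mu>). of_perm k * young_symmetrizer \<mu> * of_perm (inverse k))"

context
  fixes \<mu> :: "nat list" and n :: nat
  assumes \<mu>: "\<mu> \<in> partitions_of n"
begin

lemma central_symmetrizer_eq:
  "central_symmetrizer \<mu> = (\<Sum>k\<in>Sym n. of_perm k * young_symmetrizer \<mu> * of_perm (inverse k))"
  by (simp add: central_symmetrizer_def partitions_ofD(3)[OF \<mu>])

lemma irreducible_module_eq: "irreducible_module \<mu> = (\<lambda>x. x * young_symmetrizer \<mu>) ` Sym_algebra n"
  by (simp add: irreducible_module_def partitions_ofD(3)[OF \<mu>])

lemma subspace_irreducible_module: "ga.subspace (irreducible_module \<mu>)"
  unfolding ga.subspace_def irreducible_module_eq
proof (intro conjI ballI allI)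
  show "0 \<in> (\<lambda>x. x * young_symmetrizer \<mu>) ` Sym_algebra n"
    using ga.subspace_0[OF subspace_Sym_algebra] by (intro image_eqI[of _ _ 0]) auto
next
  fix x y :: "'a group_algebra"
  assume "x \<in> (\<lambda>x. x * young_symmetrizer \<mu>) ` Sym_algebra n"
    "y \<in> (\<lambda>x. x * young_symmetrizer \<mu>) ` Sym_algebra n"
  then show "x + y \<in> (\<lambda>x. x * young_symmetrizer \<mu>) ` Sym_algebra n"
    by (auto simp flip: distrib_right)
next
  fix c and x :: "'a group_algebra"
  assume "x \<in> (\<lambda>x. x * young_symmetrizer \<mu>) ` Sym_algebra n"
  then show "ga_scale c x \<in> (\<lambda>x. x * young_symmetrizer \<mu>) ` Sym_algebra n"
    by (auto simp flip: ga_scale_mult_left)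
qed

lemma irreducible_module_subset: "irreducible_module \<mu> \<subseteq> Sym_algebra n"
  unfolding irreducible_module_eq using young_symmetrizer_in[OF \<mu>] by auto

text \<open>
  Right multiplication by the Young symmetrizer acts on the module as the scalar \<open>young_norm \<mu>\<close> and
  maps the group algebra into the module. It thus turns the trace on the module into a trace on the
  group algebra, whose diagonal coefficients are those of the conjugates of the Young symmetrizer.
  The scalar is kept on the left-hand side because this formula is what shows that it is not 0.
\<close>

lemma young_norm_mult_character:
  fixes g :: "nat perm"
  assumes g: "g \<in> Sym n"
  shows "young_norm \<mu> * irreducible_character \<mu> g =
    (ga_coeff (central_symmetrizer \<mu>) (inverse g) :: 'a::field_char_0)"
proof -
  let ?W = "irreducible_module \<mu> :: 'a group_algebra set"
  let ?e = "young_symmetrizer \<mu> :: 'a group_algebra"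
  have gW: "of_perm g * x \<in> ?W" if "x \<in> ?W" for x
  proof -
    from that obtain y where "y \<in> Sym_algebra n" "x = y * ?e" by (auto simp: irreducible_module_eq)
    with g show ?thesis
      unfolding irreducible_module_eq
      by (intro image_eqI[of _ _ "of_perm g * y"]) (auto simp: mult.assoc)
  qed
  have We: "x * ?e = ga_scale (young_norm \<mu>) x" if "x \<in> ?W" for x
    using that by (auto simp: irreducible_module_eq mult.assoc young_symmetrizer_square[OF \<mu>]
        ga_scale_mult_right)
  have "young_norm \<mu> * irreducible_character \<mu> g = trace_on ?W (\<lambda>x. of_perm g * x * ?e)"
    unfolding irreducible_character_def
    by (rule trace_on_scale[symmetric, OF subspace_irreducible_module irreducible_module_subset])
       (auto simp: gW We mult.assoc ga_scale_mult_right)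
  also have "\<dots> = (\<Sum>k\<in>Sym n. ga_coeff (of_perm g * of_perm k * ?e) k)"
  proof (rule trace_on_eq_sum_coeff[OF subspace_irreducible_module irreducible_module_subset])
    fix x :: "'a group_algebra" assume "x \<in> Sym_algebra n"
    then show "of_perm g * x * ?e \<in> ?W"
      using g by (auto simp: irreducible_module_eq)
  qed
  also have "\<dots> = (\<Sum>k\<in>Sym n. ga_coeff ?e (inverse k * inverse g * k))"
    by (simp add: ga_coeff_of_perm_mult mult.assoc)
  also have "\<dots> = ga_coeff (central_symmetrizer \<mu>) (inverse g)"
    by (simp add: central_symmetrizer_eq lookup_sum ga_coeff_of_perm_mult ga_coeff_mult_of_perm mult.assoc)
  finally show ?thesis .
qed

lemma ga_coeff_central_symmetrizer_one: "ga_coeff (central_symmetrizer \<mu>) 1 = fact n"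
  by (simp add: central_symmetrizer_eq lookup_sum ga_coeff_of_perm_mult ga_coeff_mult_of_perm
      ga_coeff_young_symmetrizer_one[OF \<mu>] card_Sym)

lemma young_norm_mult_dimension:
  "young_norm \<mu> * irreducible_character \<mu> 1 = (fact n :: 'a::field_char_0)"
  using young_norm_mult_character[OF Sym_one] by (simp add: ga_coeff_central_symmetrizer_one)

lemma young_norm_nonzero: "young_norm \<mu> \<noteq> (0 :: 'a::field_char_0)"
  using young_norm_mult_dimension[where 'a = 'a] by auto

lemma young_symmetrizer_nonzero: "young_symmetrizer \<mu> \<noteq> (0 :: 'a::field_char_0 group_algebra)"
  using ga_coeff_young_symmetrizer_one[OF \<mu>, where 'a = 'a] by auto

lemma central_symmetrizer_in: "central_symmetrizer \<mu> \<in> Sym_algebra n"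
  unfolding central_symmetrizer_eq using young_symmetrizer_in[OF \<mu>] by (auto intro!: Sym_algebra_sum)

lemma central_symmetrizer_commutes: "commutes_with_Sym n (central_symmetrizer \<mu>)"
  unfolding commutes_with_Sym_def
proof
  fix g assume g: "g \<in> Sym n"
  let ?F = "\<lambda>k. of_perm k * young_symmetrizer \<mu> * of_perm (inverse k * g) :: 'a group_algebra"
  have "of_perm g * central_symmetrizer \<mu> = (\<Sum>k\<in>Sym n. ?F (g * k))"
    by (simp add: central_symmetrizer_eq sum_distrib_left of_perm_mult mult.assoc)
  also have "\<dots> = (\<Sum>k\<in>Sym n. ?F k)"
    by (rule sum_Sym_left[OF g])
  also have "\<dots> = central_symmetrizer \<mu> * of_perm g"
    by (simp add: central_symmetrizer_eq sum_distrib_right of_perm_mult mult.assoc)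
  finally show "of_perm g * central_symmetrizer \<mu> = central_symmetrizer \<mu> * (of_perm g :: 'a group_algebra)" .
qed

text \<open>
  In each summand the Young symmetrizers enclose a permutation and give a multiple of themselves.
  The trace form identifies the multiple as a coefficient of the Young symmetrizer.
\<close>

lemma central_symmetrizer_mult_same:
  "central_symmetrizer \<mu> * young_symmetrizer \<mu> =
    ga_scale ((young_norm \<mu>)\<^sup>2) (young_symmetrizer \<mu> :: 'a::field_char_0 group_algebra)"
proof -
  let ?e = "young_symmetrizer \<mu> :: 'a group_algebra"
  have "?e * of_perm (inverse k) * ?e = ga_scale (young_norm \<mu> * ga_coeff ?e k) ?e" if "k \<in> Sym n" for k
  proof -
    have "ga_coeff (?e * of_perm (inverse k) * ?e) 1 = ga_coeff (of_perm (inverse k) * (?e * ?e)) 1"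
      using ga_coeff_one_commute[of ?e "of_perm (inverse k) * ?e"] by (simp add: mult.assoc)
    also have "\<dots> = young_norm \<mu> * ga_coeff ?e k"
      by (simp add: young_symmetrizer_square[OF \<mu>] ga_coeff_of_perm_mult)
    finally have c: "ga_coeff (?e * of_perm (inverse k) * ?e) 1 = young_norm \<mu> * ga_coeff ?e k" .
    show ?thesis
      using young_symmetrizer_sandwich[OF \<mu> of_perm_in_Sym_algebra[OF Sym_inverse[OF that]],
          where 'a = 'a]
      unfolding c .
  qed
  then have "central_symmetrizer \<mu> * ?e =
      (\<Sum>k\<in>Sym n. of_perm k * ga_scale (young_norm \<mu> * ga_coeff ?e k) ?e)"
    by (simp add: central_symmetrizer_eq sum_distrib_right mult.assoc)
  also have "\<dots> = ga_scale (young_norm \<mu>) ((\<Sum>k\<in>Sym n. ga_scale (ga_coeff ?e k) (of_perm k)) * ?e)"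
    by (simp add: ga_scale_mult_right ga_scale_mult_left sum_distrib_right ga.scale_sum_right)
  also have "(\<Sum>k\<in>Sym n. ga_scale (ga_coeff ?e k) (of_perm k)) = ?e"
    by (rule Sym_algebra_expand[OF young_symmetrizer_in[OF \<mu>], symmetric])
  finally show ?thesis
    by (simp add: young_symmetrizer_square[OF \<mu>] power2_eq_square)
qed

lemma central_symmetrizer_mult_other:
  assumes "\<nu> \<in> partitions_of n" "\<mu> \<noteq> \<nu>"
  shows "central_symmetrizer \<mu> * young_symmetrizer \<nu> = (0 :: 'a::field_char_0 group_algebra)"
proof -
  have "young_symmetrizer \<mu> * of_perm (inverse k) * young_symmetrizer \<nu> = (0 :: 'a group_algebra)"
    if "k \<in> Sym n" for k
    using that by (intro young_symmetrizer_orthogonal[OF \<mu> assms(1) _ assms(2)]) auto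
  then show ?thesis
    by (simp add: central_symmetrizer_eq sum_distrib_right mult.assoc)
qed

end


section \<open>The center of the group algebra\<close>

lemma ga_coeff_class_sum: "ga_coeff (class_sum n \<alpha>) g = (if g \<in> conj_class n \<alpha> then 1 else 0)"
  by (simp add: class_sum_def lookup_sum ga_coeff_of_perm)

lemma independent_image_of_test:
  assumes "finite I" "inj_on F I"
    and "\<And>c i. (\<Sum>j\<in>I. ga_scale (c j) (F j)) = 0 \<Longrightarrow> i \<in> I \<Longrightarrow> c i = 0"
  shows "ga.independent (F ` I)"
proof (rule ga.independent_if_scalars_zero)
  fix c x assume *: "(\<Sum>x\<in>F ` I. ga_scale (c x) x) = 0" and "x \<in> F ` I"
  then obtain i where i: "i \<in> I" "x = F i" by blast
  from * have "(\<Sum>j\<in>I. ga_scale (c (F j)) (F j)) = 0"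
    by (simp add: sum.reindex[OF assms(2)])
  from assms(3)[OF this i(1)] show "c x = 0" by (simp add: i(2))
qed (use assms(1) in simp)

lemma conj_class_coeff_sum:
  assumes "\<alpha> \<in> partitions_of n" "g \<in> conj_class n \<alpha>"
  shows "(\<Sum>\<beta>\<in>partitions_of n. c \<beta> * ga_coeff (class_sum n \<beta>) g) = c \<alpha>"
proof -
  have "c \<beta> * ga_coeff (class_sum n \<beta>) g = (if \<beta> = \<alpha> then c \<beta> else 0)"
    if \<beta>: "\<beta> \<in> partitions_of n" for \<beta>
  proof (cases "\<beta> = \<alpha>")
    case True
    then show ?thesis using assms(2) by (simp add: ga_coeff_class_sum)
  next
    case False
    then have "g \<notin> conj_class n \<beta>" using conj_class_disjoint[OF \<beta> assms(1) _ assms(2)] by metis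
    with False show ?thesis by (simp add: ga_coeff_class_sum)
  qed
  then show ?thesis using assms(1) by simp
qed

lemma inj_on_class_sum:
  "inj_on (class_sum n :: nat list \<Rightarrow> 'a::field group_algebra) (partitions_of n)"
proof (rule inj_onI)
  fix \<alpha> \<beta> assume *: "\<alpha> \<in> partitions_of n" "\<beta> \<in> partitions_of n"
    "class_sum n \<alpha> = (class_sum n \<beta> :: 'a group_algebra)"
  obtain g where g: "g \<in> conj_class n \<alpha>" using conj_class_nonempty[OF *(1)] by blast
  then have "ga_coeff (class_sum n \<beta> :: 'a group_algebra) g = 1"
    by (simp add: ga_coeff_class_sum flip: *(3))
  then have "g \<in> conj_class n \<beta>" by (simp add: ga_coeff_class_sum split: if_splits)
  then show "\<alpha> = \<beta>" using conj_class_disjoint[OF *(1,2) g] by blast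
qed

lemma independent_class_sums:
  "ga.independent (class_sum n ` partitions_of n :: 'a::field group_algebra set)"
proof (rule independent_image_of_test[OF finite_partitions_of inj_on_class_sum])
  fix c :: "nat list \<Rightarrow> 'a" and \<alpha>
  assume *: "(\<Sum>\<beta>\<in>partitions_of n. ga_scale (c \<beta>) (class_sum n \<beta>)) = 0" and \<alpha>: "\<alpha> \<in> partitions_of n"
  obtain g where g: "g \<in> conj_class n \<alpha>" using conj_class_nonempty[OF \<alpha>] by blast
  have "0 = ga_coeff (\<Sum>\<beta>\<in>partitions_of n. ga_scale (c \<beta>) (class_sum n \<beta>)) g"
    by (simp add: *)
  also have "\<dots> = c \<alpha>"
    by (simp add: lookup_sum conj_class_coeff_sum[OF \<alpha> g])
  finally show "c \<alpha> = 0" by simp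
qed

lemma class_coeff_eq_ga_coeff:
  fixes x :: "'a::field group_algebra"
  assumes x: "x \<in> ga.span (class_sum n ` partitions_of n)"
    and \<alpha>: "\<alpha> \<in> partitions_of n" and g: "g \<in> conj_class n \<alpha>"
  shows "class_coeff n \<alpha> x = ga_coeff x g"
proof -
  let ?A = "class_sum n ` partitions_of n :: 'a group_algebra set"
  have "(\<Sum>b\<in>?A. ga_scale (ga.representation ?A x b) b) = x"
    using independent_class_sums x by (rule ga.sum_representation_eq) simp_all
  then have "ga_coeff x g = ga_coeff (\<Sum>b\<in>?A. ga_scale (ga.representation ?A x b) b) g"
    by (rule arg_cong[OF sym])
  also have "\<dots> = (\<Sum>\<beta>\<in>partitions_of n. class_coeff n \<beta> x * ga_coeff (class_sum n \<beta>) g)"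
    by (simp add: sum.reindex[OF inj_on_class_sum] lookup_sum class_coeff_def)
  also have "\<dots> = class_coeff n \<alpha> x"
    by (rule conj_class_coeff_sum[OF \<alpha> g])
  finally show ?thesis ..
qed

lemma central_in_span_class_sums:
  fixes x :: "'a::field group_algebra"
  assumes x: "x \<in> Sym_algebra n" "commutes_with_Sym n x"
  shows "x \<in> ga.span (class_sum n ` partitions_of n)"
proof -
  define rep where "rep \<alpha> = (SOME g. g \<in> conj_class n \<alpha>)" for \<alpha>
  have rep: "rep \<alpha> \<in> conj_class n \<alpha>" if "\<alpha> \<in> partitions_of n" for \<alpha>
    using conj_class_nonempty[OF that] unfolding rep_def by (simp add: some_in_eq)
  have "x = (\<Sum>\<alpha>\<in>partitions_of n. ga_scale (ga_coeff x (rep \<alpha>)) (class_sum n \<alpha>))"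
  proof (rule poly_mapping_eqI)
    fix g
    show "ga_coeff x g = ga_coeff (\<Sum>\<alpha>\<in>partitions_of n. ga_scale (ga_coeff x (rep \<alpha>)) (class_sum n \<alpha>)) g"
    proof (cases "g \<in> Sym n")
      case True
      then obtain \<alpha> where \<alpha>: "\<alpha> \<in> partitions_of n" "g \<in> conj_class n \<alpha>"
        by (rule ex_partition_of_cycle_type)
      obtain k where "k \<in> Sym n" "g = k * rep \<alpha> * inverse k"
        by (rule conj_class_conjugate[OF rep[OF \<alpha>(1)] \<alpha>(2)])
      then have "ga_coeff x g = ga_coeff x (rep \<alpha>)"
        using ga_coeff_conj[OF x(2)] by simp
      then show ?thesis
        using conj_class_coeff_sum[OF \<alpha>, of "\<lambda>\<beta>. ga_coeff x (rep \<beta>)"] by (simp add: lookup_sum)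
    next
      case False
      then have "ga_coeff x g = 0"
        using x(1) by (auto simp: Sym_algebra_def in_keys_iff)
      with False show ?thesis
        by (auto simp: lookup_sum ga_coeff_class_sum conj_class_def)
    qed
  qed
  then show ?thesis
    by (metis (no_types, lifting) ga.span_sum ga.span_scale ga.span_base imageI)
qed

lemma inj_on_central_symmetrizer:
  "inj_on (central_symmetrizer :: _ \<Rightarrow> 'a::field_char_0 group_algebra) (partitions_of n)"
proof (rule inj_onI, rule ccontr)
  fix \<mu> \<nu> assume *: "\<mu> \<in> partitions_of n" "\<nu> \<in> partitions_of n" "\<mu> \<noteq> \<nu>"
    "central_symmetrizer \<mu> = (central_symmetrizer \<nu> :: 'a group_algebra)"
  have "ga_scale ((young_norm \<nu>)\<^sup>2) (young_symmetrizer \<nu>) = (0 :: 'a group_algebra)"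
    using central_symmetrizer_mult_other[OF *(1,2,3), where 'a = 'a]
      central_symmetrizer_mult_same[OF *(2), where 'a = 'a] *(4) by simp
  then show False
    using young_symmetrizer_nonzero[OF *(2), where 'a = 'a] young_norm_nonzero[OF *(2), where 'a = 'a]
    by simp
qed

text \<open>
  Multiplication by a Young symmetrizer singles out one coordinate. This yields the independence of
  the central symmetrizers as well as the coordinates of a given central element.
\<close>

lemma sum_central_symmetrizer_mult:
  fixes c :: "nat list \<Rightarrow> 'a::field_char_0"
  assumes "\<nu> \<in> partitions_of n"
  shows "(\<Sum>\<mu>\<in>partitions_of n. ga_scale (c \<mu>) (central_symmetrizer \<mu>)) * young_symmetrizer \<nu> =
    ga_scale (c \<nu> * (young_norm \<nu>)\<^sup>2) (young_symmetrizer \<nu>)"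
proof -
  have "(\<Sum>\<mu>\<in>partitions_of n. ga_scale (c \<mu>) (central_symmetrizer \<mu>)) * young_symmetrizer \<nu> =
      (\<Sum>\<mu>\<in>partitions_of n. if \<mu> = \<nu> then ga_scale (c \<nu> * (young_norm \<nu>)\<^sup>2) (young_symmetrizer \<nu>) else 0)"
    unfolding sum_distrib_right
    by (intro sum.cong refl)
       (auto simp: ga_scale_mult_left central_symmetrizer_mult_same[OF assms]
          central_symmetrizer_mult_other[OF _ assms])
  then show ?thesis using assms by simp
qed

lemma independent_central_symmetrizers:
  "ga.independent (central_symmetrizer ` partitions_of n :: 'a::field_char_0 group_algebra set)"
proof (rule independent_image_of_test[OF finite_partitions_of inj_on_central_symmetrizer])
  fix c :: "nat list \<Rightarrow> 'a" and \<nu>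
  assume *: "(\<Sum>\<mu>\<in>partitions_of n. ga_scale (c \<mu>) (central_symmetrizer \<mu>)) = 0"
    and \<nu>: "\<nu> \<in> partitions_of n"
  have "ga_scale (c \<nu> * (young_norm \<nu>)\<^sup>2) (young_symmetrizer \<nu>) = (0 :: 'a group_algebra)"
    using sum_central_symmetrizer_mult[OF \<nu>, of c] * by simp
  then show "c \<nu> = 0"
    using young_symmetrizer_nonzero[OF \<nu>, where 'a = 'a] young_norm_nonzero[OF \<nu>, where 'a = 'a]
    by simp
qed

text \<open>
  A counting argument: there are as many central symmetrizers as class sums, so that another
  independent central element would exceed the dimension of the center. In terms of modules, this
  says that the list of irreducible modules is complete.
\<close>

lemma span_central_symmetrizers:
  "ga.span (class_sum n ` partitions_of n) \<subseteq>
    ga.span (central_symmetrizer ` partitions_of n :: 'a::field_char_0 group_algebra set)"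
proof -
  let ?C = "class_sum n ` partitions_of n :: 'a group_algebra set"
  let ?E = "central_symmetrizer ` partitions_of n :: 'a group_algebra set"
  have E: "?E \<subseteq> ga.span ?C"
    using central_in_span_class_sums[OF central_symmetrizer_in central_symmetrizer_commutes] by blast
  have "card ?C = card ?E"
    by (simp add: card_image inj_on_class_sum inj_on_central_symmetrizer)
  have "c \<in> ga.span ?E" if "c \<in> ?C" for c
  proof (rule ccontr)
    assume c: "c \<notin> ga.span ?E"
    then have "ga.independent (insert c ?E)"
      by (rule ga.independent_insertI[OF _ independent_central_symmetrizers])
    moreover have "insert c ?E \<subseteq> ga.span ?C"
      using E that by (auto intro: ga.span_base)
    ultimately have "card (insert c ?E) \<le> card ?C"
      using ga.independent_span_bound[of ?C "insert c ?E"] by simp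
    moreover have "c \<notin> ?E" using c ga.span_base by blast
    ultimately show False
      using \<open>card ?C = card ?E\<close> by simp
  qed
  then show ?thesis
    by (intro ga.span_minimal ga.subspace_span) blast
qed

text \<open>
  Fourier inversion on the center: comparing the products with each Young symmetrizer determines the
  coordinates from the eigenvalues.
\<close>

lemma central_expansion:
  fixes x :: "'a::field_char_0 group_algebra"
  assumes x: "x \<in> Sym_algebra n" "commutes_with_Sym n x"
    and \<omega>: "\<And>\<mu>. \<mu> \<in> partitions_of n \<Longrightarrow> x * young_symmetrizer \<mu> = ga_scale (\<omega> \<mu>) (young_symmetrizer \<mu>)"
  shows "x = (\<Sum>\<mu>\<in>partitions_of n. ga_scale (\<omega> \<mu> / (young_norm \<mu>)\<^sup>2) (central_symmetrizer \<mu>))"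
proof -
  let ?E = "central_symmetrizer ` partitions_of n :: 'a group_algebra set"
  have "x \<in> ga.span ?E"
    using central_in_span_class_sums[OF x] span_central_symmetrizers by blast
  then obtain u where "x = (\<Sum>b\<in>?E. ga_scale (u b) b)"
    by (auto simp: ga.span_finite)
  then have x_eq: "x = (\<Sum>\<mu>\<in>partitions_of n. ga_scale (u (central_symmetrizer \<mu>)) (central_symmetrizer \<mu>))"
    by (simp add: sum.reindex[OF inj_on_central_symmetrizer])
  have "u (central_symmetrizer \<mu>) = \<omega> \<mu> / (young_norm \<mu>)\<^sup>2" if \<mu>: "\<mu> \<in> partitions_of n" for \<mu>
  proof -
    have "ga_scale (\<omega> \<mu>) (young_symmetrizer \<mu>) =
        ga_scale (u (central_symmetrizer \<mu>) * (young_norm \<mu>)\<^sup>2) (young_symmetrizer \<mu>)"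
      unfolding \<omega>[OF \<mu>, symmetric] by (subst x_eq) (rule sum_central_symmetrizer_mult[OF \<mu>])
    then show ?thesis
      using young_norm_nonzero[OF \<mu>, where 'a = 'a] young_symmetrizer_nonzero[OF \<mu>, where 'a = 'a]
      by (simp add: field_simps)
  qed
  then show ?thesis
    by (subst x_eq) (simp cong: sum.cong)
qed


section \<open>Jucys--Murphy elements act on the Young symmetrizer by contents\<close>

definition Sym_on :: "nat set \<Rightarrow> nat perm set" where
  "Sym_on U = {g. affected g \<subseteq> U}"

lemma Sym_on_subset: "U \<subseteq> {1..n} \<Longrightarrow> Sym_on U \<subseteq> Sym n"
  by (auto simp: Sym_on_def Sym_def)

lemma Sym_on_mult: "g \<in> Sym_on U \<Longrightarrow> h \<in> Sym_on U \<Longrightarrow> g * h \<in> Sym_on U"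
  using affected_times[of g h] unfolding Sym_on_def by blast

lemma Sym_on_mono: "U \<subseteq> V \<Longrightarrow> Sym_on U \<subseteq> Sym_on V"
  by (auto simp: Sym_on_def)

lemma swap_in_Sym_on: "i \<in> U \<Longrightarrow> j \<in> U \<Longrightarrow> \<langle>i \<leftrightarrow> j\<rangle> \<in> Sym_on U"
  by (cases "i = j") (auto simp: Sym_on_def affected_swap)

text \<open>
  The transpositions \<open>(j m)\<close>, with the identity for \<open>j = m\<close>, represent the cosets of the stabilizer
  of \<open>m\<close>: a permutation is in the coset given by the image of \<open>m\<close>.
\<close>

lemma sum_Sym_on_insert:
  assumes "m \<notin> U"
  shows "(\<Sum>g\<in>Sym_on (insert m U). of_perm g) =
    (\<Sum>j\<in>insert m U. of_perm \<langle>j \<leftrightarrow> m\<rangle>) * (\<Sum>g\<in>Sym_on U. of_perm g)"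
proof -
  let ?U' = "insert m U"
  have fix_m: "g \<langle>$\<rangle> m = m" if "g \<in> Sym_on U" for g
    using that assms by (auto simp: Sym_on_def in_affected)
  have "(\<Sum>j\<in>?U'. of_perm \<langle>j \<leftrightarrow> m\<rangle>) * (\<Sum>g\<in>Sym_on U. of_perm g) =
      (\<Sum>(j, g)\<in>?U' \<times> Sym_on U. of_perm (\<langle>j \<leftrightarrow> m\<rangle> * g))"
    by (simp add: sum_product sum.cartesian_product of_perm_mult)
  also have "\<dots> = (\<Sum>g\<in>Sym_on ?U'. of_perm g)"
  proof (rule sum.reindex_bij_witness[of _ "\<lambda>g. (g \<langle>$\<rangle> m, \<langle>g \<langle>$\<rangle> m \<leftrightarrow> m\<rangle> * g)" "\<lambda>(j, g). \<langle>j \<leftrightarrow> m\<rangle> * g"])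
    fix p assume "p \<in> ?U' \<times> Sym_on U"
    then obtain j g where p: "p = (j, g)" "j \<in> ?U'" "g \<in> Sym_on U" by blast
    show "(\<lambda>g. (g \<langle>$\<rangle> m, \<langle>g \<langle>$\<rangle> m \<leftrightarrow> m\<rangle> * g)) ((\<lambda>(j, g). \<langle>j \<leftrightarrow> m\<rangle> * g) p) = p"
      using fix_m[OF p(3)] by (simp add: p(1) mult.assoc[symmetric])
    show "(\<lambda>(j, g). \<langle>j \<leftrightarrow> m\<rangle> * g) p \<in> Sym_on ?U'"
      using p Sym_on_mono[of U ?U'] by (auto intro!: Sym_on_mult swap_in_Sym_on)
    show "of_perm ((\<lambda>(j, g). \<langle>j \<leftrightarrow> m\<rangle> * g) p) =
        (case p of (j, g) \<Rightarrow> of_perm (\<langle>j \<leftrightarrow> m\<rangle> * g))"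
      by (simp add: p(1))
  next
    fix g assume g: "g \<in> Sym_on ?U'"
    show "(\<lambda>(j, g). \<langle>j \<leftrightarrow> m\<rangle> * g) (g \<langle>$\<rangle> m, \<langle>g \<langle>$\<rangle> m \<leftrightarrow> m\<rangle> * g) = g"
      by (simp add: mult.assoc[symmetric])
    have gm: "g \<langle>$\<rangle> m \<in> ?U'"
    proof (cases "g \<langle>$\<rangle> m = m")
      case False
      then have "g \<langle>$\<rangle> m \<in> affected g" by (simp add: in_affected apply_inj)
      then show ?thesis using g unfolding Sym_on_def by blast
    qed simp
    have "\<langle>g \<langle>$\<rangle> m \<leftrightarrow> m\<rangle> * g \<in> Sym_on ?U'"
      using gm g by (intro Sym_on_mult swap_in_Sym_on) auto
    moreover have "m \<notin> affected (\<langle>g \<langle>$\<rangle> m \<leftrightarrow> m\<rangle> * g)"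
      by (simp add: in_affected)
    ultimately have "\<langle>g \<langle>$\<rangle> m \<leftrightarrow> m\<rangle> * g \<in> Sym_on U"
      unfolding Sym_on_def by blast
    with gm show "(g \<langle>$\<rangle> m, \<langle>g \<langle>$\<rangle> m \<leftrightarrow> m\<rangle> * g) \<in> ?U' \<times> Sym_on U"
      by blast
  qed
  finally show ?thesis ..
qed

lemma sum_Sym_on_absorb:
  assumes "h \<in> Sym_on U"
  shows "(\<Sum>g\<in>Sym_on U. of_perm g) * of_perm h = (\<Sum>g\<in>Sym_on U. of_perm g)"
proof -
  have inv: "inverse h \<in> Sym_on U" using assms by (simp add: Sym_on_def)
  have "(\<Sum>g\<in>Sym_on U. of_perm g) * of_perm h = (\<Sum>g\<in>Sym_on U. of_perm (g * h))"
    by (simp add: sum_distrib_right of_perm_mult)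
  also have "\<dots> = (\<Sum>g\<in>Sym_on U. of_perm g)"
    by (rule sum.reindex_bij_witness[of _ "\<lambda>g. g * inverse h" "\<lambda>g. g * h"])
       (auto simp: mult.assoc Sym_on_mult assms inv)
  finally show ?thesis .
qed

context
  fixes \<mu> :: "nat list" and n m :: nat
  assumes \<mu>: "\<mu> \<in> partitions_of n" and m: "m \<in> {1..n}"
begin

text \<open>
  A Garnir relation. As the row group contains the permutations of the row \<open>R\<close>, the sum over \<open>j\<close> acts
  on the Young symmetrizer like the symmetrizing sum of \<open>R\<close> together with the entry \<open>m\<close> of a lower
  row, up to a factor. This annihilates: wherever an element of the row group puts \<open>m\<close> within its
  row, the row above, which is at least as long, has an entry in the same column.
\<close>

lemma sum_swap_row_annihilates:
  assumes r: "r < row_of \<mu> m"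
  defines "R \<equiv> {j \<in> {1..n}. row_of \<mu> j = r}"
  shows "(\<Sum>j\<in>insert m R. of_perm \<langle>j \<leftrightarrow> m\<rangle>) * young_symmetrizer \<mu> = (0 :: 'a::field_char_0 group_algebra)"
proof -
  let ?f = "row_of \<mu>" and ?f' = "col_of \<mu>"
  let ?S = "\<lambda>U. (\<Sum>g\<in>Sym_on U. of_perm g) :: 'a group_algebra"
  let ?U = "insert m R"
  have sub: "?U \<subseteq> {1..n}" "R \<subseteq> {1..n}" using m by (auto simp: R_def)
  have "m \<notin> R" using r by (auto simp: R_def)
  have R_stab: "Sym_on R \<subseteq> stabilizer n ?f"
  proof
    fix g assume g: "g \<in> Sym_on R"
    have "?f (g \<langle>$\<rangle> j) = ?f j" for j
    proof (cases "j \<in> affected g")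
      case True
      then have "j \<in> R" "g \<langle>$\<rangle> j \<in> R" using g apply_affected[of g j] by (auto simp: Sym_on_def)
      then show ?thesis by (simp add: R_def)
    qed (simp add: in_affected)
    then show "g \<in> stabilizer n ?f"
      using g Sym_on_subset[OF sub(2)] by (auto simp: stabilizer_def)
  qed
  have zero: "?S ?U * of_perm g * alt_sum n ?f' = 0" if g: "g \<in> stabilizer n ?f" for g
  proof -
    have gS: "g \<in> Sym n" using g stabilizer_subset_Sym by blast
    \<comment> \<open>\<open>m'\<close> is the entry that \<open>g\<close> moves to \<open>m\<close>, and \<open>j'\<close> the entry above it in the row \<open>r\<close>\<close>
    define m' where "m' = inverse g \<langle>$\<rangle> m"
    have m': "m' \<in> {1..n}"
      unfolding m'_def using m by (simp only: Sym_apply_in[OF Sym_inverse[OF gS]])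
    have row_m': "?f m' = ?f m"
      using stabilizer_inverse[OF g] m by (simp add: stabilizer_def m'_def)
    have cell_m': "(?f m, ?f' m') \<in> cells \<mu>"
      using coordinates_in_cells[OF \<mu> m'] by (simp add: row_m')
    then have cell: "(r, ?f' m') \<in> cells \<mu>"
      using r by (simp add: cells_iff_column_height[OF \<mu>])
    define j' where "j' = tableau \<mu> (r, ?f' m')"
    have j': "j' \<in> {1..n}" "?f j' = r" "?f' j' = ?f' m'"
      using tableau_in[OF \<mu> cell] cell by (auto simp: j'_def)
    have "g \<langle>$\<rangle> j' \<in> {1..n}" using j'(1) by (simp only: Sym_apply_in[OF gS])
    moreover have "?f (g \<langle>$\<rangle> j') = ?f j'" using g j'(1) by (simp add: stabilizer_def)
    ultimately have gj: "g \<langle>$\<rangle> j' \<in> R" using j'(2) by (simp add: R_def)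
    let ?t = "\<langle>g \<langle>$\<rangle> j' \<leftrightarrow> m\<rangle>" and ?t' = "\<langle>j' \<leftrightarrow> m'\<rangle>"
    have "?t \<in> Sym_on ?U" using gj by (intro swap_in_Sym_on) auto
    then have "?S ?U * of_perm g * alt_sum n ?f' = ?S ?U * of_perm ?t * of_perm g * alt_sum n ?f'"
      by (simp add: sum_Sym_on_absorb)
    also have "of_perm ?t * of_perm g = (of_perm g * of_perm ?t' :: 'a group_algebra)"
      by (simp add: swap_conj m'_def flip: of_perm_mult)
    then have "?S ?U * of_perm ?t * of_perm g * alt_sum n ?f' =
        ?S ?U * of_perm g * (of_perm ?t' * alt_sum n ?f')"
      by (simp add: mult.assoc)
    also have "of_perm ?t' * alt_sum n ?f' = - (alt_sum n ?f' :: 'a group_algebra)"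
    proof -
      have "j' \<noteq> m'" using j'(2) row_m' r by auto
      moreover have "?t' \<in> stabilizer n ?f'"
        by (rule swap_in_stabilizer[OF j'(1) m' j'(3)])
      ultimately show ?thesis by (simp add: alt_sum_absorb perm_sign_swap)
    qed
    also have "?S ?U * of_perm g * - alt_sum n ?f' = - (?S ?U * of_perm g * alt_sum n ?f')"
      by simp
    finally show ?thesis by (rule ga_eq_uminusD)
  qed
  have absorb: "?S R * young_symmetrizer \<mu> = ga_scale (of_nat (card (Sym_on R))) (young_symmetrizer \<mu>)"
  proof -
    have "of_perm g * young_symmetrizer \<mu> = (young_symmetrizer \<mu> :: 'a group_algebra)" if "g \<in> Sym_on R" for g
      by (simp add: young_symmetrizer_eq[OF \<mu>] sym_sum_absorb(1)[OF subsetD[OF R_stab that]]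
          flip: mult.assoc)
    then show ?thesis by (simp add: sum_distrib_right ga_scale_of_nat)
  qed
  have expand: "x * (sym_sum n ?f * y) = (\<Sum>g\<in>stabilizer n ?f. x * of_perm g * y)"
    for x y :: "'a group_algebra"
    by (simp add: sym_sum_def sum_distrib_left sum_distrib_right mult.assoc)
  have "0 = ?S ?U * young_symmetrizer \<mu>"
    unfolding young_symmetrizer_eq[OF \<mu>] expand by (rule sum.neutral[symmetric]) (use zero in blast)
  also have "\<dots> = (\<Sum>j\<in>?U. of_perm \<langle>j \<leftrightarrow> m\<rangle>) * (?S R * young_symmetrizer \<mu>)"
    by (simp only: sum_Sym_on_insert[OF \<open>m \<notin> R\<close>] mult.assoc)
  also have "\<dots> = ga_scale (of_nat (card (Sym_on R))) ((\<Sum>j\<in>?U. of_perm \<langle>j \<leftrightarrow> m\<rangle>) * young_symmetrizer \<mu>)"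
    unfolding absorb ga_scale_mult_right ..
  finally have "ga_scale (of_nat (card (Sym_on R)))
      ((\<Sum>j\<in>?U. of_perm \<langle>j \<leftrightarrow> m\<rangle>) * young_symmetrizer \<mu>) = (0 :: 'a group_algebra)" ..
  moreover have "finite (Sym_on R)" "1 \<in> Sym_on R"
    using finite_subset[OF R_stab] by (auto simp: Sym_on_def)
  then have "card (Sym_on R) \<noteq> 0" by auto
  ultimately show ?thesis by simp
qed

lemma predecessors_eq:
  "{1..<m} = {j \<in> {1..n}. row_of \<mu> j = row_of \<mu> m \<and> col_of \<mu> j < col_of \<mu> m} \<union>
    {j \<in> {1..n}. row_of \<mu> j < row_of \<mu> m}"
proof -
  have less_iff: "j < m \<longleftrightarrow> row_of \<mu> j < row_of \<mu> m \<or>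
      (row_of \<mu> j = row_of \<mu> m \<and> col_of \<mu> j < col_of \<mu> m)" if j: "j \<in> {1..n}" for j
  proof -
    obtain r c r' c' where rc: "row_of \<mu> j = r" "col_of \<mu> j = c" "row_of \<mu> m = r'" "col_of \<mu> m = c'"
      by blast
    have eq: "tableau \<mu> (r, c) = j" "tableau \<mu> (r', c') = m"
      using tableau_coordinates[OF \<mu> j] tableau_coordinates[OF \<mu> m] by (simp_all add: rc)
    have cells: "(r, c) \<in> cells \<mu>" "(r', c') \<in> cells \<mu>"
      using coordinates_in_cells[OF \<mu> j] coordinates_in_cells[OF \<mu> m] by (simp_all add: rc)
    have "r < r' \<Longrightarrow> j < m" "r' < r \<Longrightarrow> m < j"
      using tableau_less[OF cells(1), of r' c'] tableau_less[OF cells(2), of r c] eq by simp_all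
    moreover have "r = r' \<Longrightarrow> j < m \<longleftrightarrow> c < c'"
      using eq by (auto simp: tableau_def)
    ultimately show ?thesis
      unfolding rc by (cases r r' rule: linorder_cases) auto
  qed
  have "{1..<m} = {j \<in> {1..n}. j < m}" using m by auto
  also have "\<dots> = {j \<in> {1..n}. row_of \<mu> j < row_of \<mu> m \<or>
      (row_of \<mu> j = row_of \<mu> m \<and> col_of \<mu> j < col_of \<mu> m)}"
    using less_iff by (intro Collect_cong) (simp cong: conj_cong)
  also have "\<dots> = {j \<in> {1..n}. row_of \<mu> j = row_of \<mu> m \<and> col_of \<mu> j < col_of \<mu> m} \<union>
    {j \<in> {1..n}. row_of \<mu> j < row_of \<mu> m}"
    by (simp only: conj_disj_distribL Collect_disj_eq Un_commute)
  finally show ?thesis .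
qed

text \<open>
  The entries before \<open>m\<close> are those to the left of it in its row, whose transpositions with \<open>m\<close> fix
  the row symmetrizer, and all entries of the higher rows, each row contributing -1 by
  \<open>sum_swap_row_annihilates\<close>. The difference of the two numbers is the content.
\<close>

lemma jucys_murphy_mult_young_symmetrizer:
  "jucys_murphy m * young_symmetrizer \<mu> =
    ga_scale (of_int (content (row_of \<mu> m, col_of \<mu> m)))
      (young_symmetrizer \<mu> :: 'a::field_char_0 group_algebra)"
proof -
  let ?e = "young_symmetrizer \<mu> :: 'a group_algebra"
  let ?A = "{j \<in> {1..n}. row_of \<mu> j = row_of \<mu> m \<and> col_of \<mu> j < col_of \<mu> m}"
  let ?B = "{j \<in> {1..n}. row_of \<mu> j < row_of \<mu> m}"
  let ?R = "\<lambda>r. {j \<in> {1..n}. row_of \<mu> j = r}"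
  let ?t = "\<lambda>j. of_perm \<langle>j \<leftrightarrow> m\<rangle> * ?e"
  have "?t j = ?e" if "j \<in> ?A" for j
  proof -
    have "\<langle>j \<leftrightarrow> m\<rangle> \<in> stabilizer n (row_of \<mu>)"
      using that m by (intro swap_in_stabilizer) auto
    then show ?thesis
      by (simp add: young_symmetrizer_eq[OF \<mu>] sym_sum_absorb flip: mult.assoc)
  qed
  then have "(\<Sum>j\<in>?A. ?t j) = ga_scale (of_nat (card ?A)) ?e"
    by (simp add: ga_scale_of_nat)
  also have "card ?A = col_of \<mu> m"
  proof -
    have "card ?A = card {c \<in> cells \<mu>. fst c = row_of \<mu> m \<and> snd c < col_of \<mu> m}"
      by (rule card_coordinates[OF \<mu>])
    also have "{c \<in> cells \<mu>. fst c = row_of \<mu> m \<and> snd c < col_of \<mu> m} =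
        {row_of \<mu> m} \<times> {..<col_of \<mu> m}"
      using coordinates_in_cells[OF \<mu> m] by (auto simp: cells_def)
    finally show ?thesis by simp
  qed
  finally have A: "(\<Sum>j\<in>?A. ?t j) = ga_scale (of_nat (col_of \<mu> m)) ?e" .
  have row: "(\<Sum>j\<in>?R r. ?t j) = - ?e" if r: "r < row_of \<mu> m" for r
  proof -
    have "m \<notin> ?R r" using r by simp
    then have "0 = ?t m + (\<Sum>j\<in>?R r. ?t j)"
      using sum_swap_row_annihilates[OF r, where 'a = 'a]
      by (simp add: sum_distrib_right distrib_right)
    then show ?thesis by (simp add: eq_neg_iff_add_eq_0 add.commute)
  qed
  have "(\<Sum>j\<in>?B. ?t j) = (\<Sum>r<row_of \<mu> m. \<Sum>j\<in>{j \<in> ?B. row_of \<mu> j = r}. ?t j)"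
    by (rule sum.group[symmetric]) auto
  also have "\<dots> = (\<Sum>r<row_of \<mu> m. - ?e)"
  proof (rule sum.cong[OF refl])
    fix r assume r: "r \<in> {..<row_of \<mu> m}"
    then have "{j \<in> ?B. row_of \<mu> j = r} = ?R r" by auto
    then show "(\<Sum>j\<in>{j \<in> ?B. row_of \<mu> j = r}. ?t j) = - ?e"
      using row[of r] r by simp
  qed
  also have "\<dots> = - ga_scale (of_nat (row_of \<mu> m)) ?e"
    by (simp add: ga_scale_of_nat)
  finally have B: "(\<Sum>j\<in>?B. ?t j) = - ga_scale (of_nat (row_of \<mu> m)) ?e" .
  have "jucys_murphy m * ?e = (\<Sum>j\<in>?A \<union> ?B. ?t j)"
    unfolding jucys_murphy_def predecessors_eq sum_distrib_right ..
  also have "\<dots> = (\<Sum>j\<in>?A. ?t j) + (\<Sum>j\<in>?B. ?t j)"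
    by (rule sum.union_disjoint) auto
  finally show ?thesis
    unfolding A B by (simp add: content_def ga.scale_left_diff_distrib)
qed

end


unbundle fps_syntax

section \<open>Products of series in Jucys--Murphy elements are central\<close>

lemma fps_const_X_power_nth:
  fixes c :: "'a::ring_1"
  shows "((fps_const c * fps_X) ^ i) $ k = (if k = i then c ^ i else 0)"
proof (induction i arbitrary: k)
  case (Suc i)
  have "((fps_const c * fps_X) ^ Suc i) $ k = c * (fps_X * (fps_const c * fps_X) ^ i) $ k"
    by (simp add: mult.assoc)
  then show ?case
    by (auto simp: Suc)
qed simp

lemma fps_compose_linear_nth:
  fixes c :: "'a::ring_1"
  shows "(f oo (fps_const c * fps_X)) $ k = f $ k * c ^ k"
  by (simp add: fps_compose_nth fps_const_X_power_nth if_distrib[of "\<lambda>x. _ * x"] cong: if_cong)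

lemma fps_mult_commute_coeffs:
  fixes a b :: "'a::ring_1 fps"
  assumes "\<And>i j. a $ i * b $ j = b $ j * a $ i"
  shows "a * b = b * a"
proof (rule fps_ext)
  fix k
  have "(a * b) $ k = (\<Sum>i=0..k. b $ (k - i) * a $ i)"
    by (simp add: fps_mult_nth assms)
  also have "\<dots> = (\<Sum>i=0..k. b $ i * a $ (k - i))"
    by (rule sum.reindex_bij_witness[of _ "\<lambda>i. k - i" "\<lambda>i. k - i"]) auto
  finally show "(a * b) $ k = (b * a) $ k"
    by (simp add: fps_mult_nth)
qed

definition jm_factor :: "'a::field fps \<Rightarrow> nat \<Rightarrow> 'a group_algebra fps" where
  "jm_factor f i = ga_fps_lift f oo (fps_const (jucys_murphy i) * fps_X)"

lemma jm_factor_nth: "jm_factor f i $ k = ga_scale (f $ k) (jucys_murphy i ^ k)"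
  by (simp add: jm_factor_def fps_compose_linear_nth ga_fps_lift_def ga_scale_def)

lemma jucys_murphy_product_0: "jucys_murphy_product f 0 = 1"
  by (simp add: jucys_murphy_product_def)

lemma jucys_murphy_product_Suc:
  "jucys_murphy_product f (Suc n) = jucys_murphy_product f n * jm_factor f (Suc n)"
  by (simp add: jucys_murphy_product_def jm_factor_def)

lemma Sym_mono: "m \<le> n \<Longrightarrow> Sym m \<subseteq> Sym n"
  by (auto simp: Sym_def)

lemma Sym_algebra_mono: "m \<le> n \<Longrightarrow> Sym_algebra m \<subseteq> Sym_algebra n"
  using Sym_mono[of m n] by (auto simp: Sym_algebra_def)

lemma Sym_algebra_zero [simp]: "0 \<in> Sym_algebra n"
  by (rule ga.subspace_0[OF subspace_Sym_algebra])

lemma jucys_murphy_in: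
  assumes "i \<le> n"
  shows "jucys_murphy i \<in> Sym_algebra n"
proof (cases "i = 0")
  case True
  then show ?thesis by (simp add: jucys_murphy_def)
next
  case False
  then show ?thesis
    unfolding jucys_murphy_def using assms
    by (intro Sym_algebra_sum of_perm_in_Sym_algebra Sym_swap) auto
qed

lemma Sym_algebra_power: "x \<in> Sym_algebra n \<Longrightarrow> x ^ k \<in> Sym_algebra n"
  by (induction k) auto

lemma jucys_murphy_product_in: "jucys_murphy_product f n $ k \<in> Sym_algebra n"
proof (induction n arbitrary: k)
  case 0
  show ?case by (simp add: jucys_murphy_product_0)
next
  case (Suc n)
  have "jucys_murphy_product f n $ i \<in> Sym_algebra (Suc n)" for i
    using Suc[of i] Sym_algebra_mono[of n "Suc n"] by auto
  moreover have "jm_factor f (Suc n) $ i \<in> Sym_algebra (Suc n)" for i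
    unfolding jm_factor_nth by (intro Sym_algebra_scale Sym_algebra_power jucys_murphy_in) simp
  ultimately show ?case
    unfolding jucys_murphy_product_Suc fps_mult_nth by (intro Sym_algebra_sum Sym_algebra_mult)
qed

text \<open>
  Conjugation by a permutation that fixes \<open>n + 1\<close> permutes the summands of \<open>J\<^sub>n\<^sub>+\<^sub>1\<close>.
\<close>

lemma jucys_murphy_commutes: "commutes_with_Sym n (jucys_murphy (Suc n))"
  unfolding commutes_with_Sym_def
proof
  fix g assume g: "g \<in> Sym n"
  have "g \<langle>$\<rangle> (Suc n) = Suc n" using g by (intro Sym_fixes[of g n]) auto
  then have swap: "g * \<langle>j \<leftrightarrow> Suc n\<rangle> = \<langle>g \<langle>$\<rangle> j \<leftrightarrow> Suc n\<rangle> * g" for j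
    by (simp add: swap_conj)
  have "of_perm g * jucys_murphy (Suc n) = (\<Sum>j\<in>{1..n}. of_perm \<langle>g \<langle>$\<rangle> j \<leftrightarrow> Suc n\<rangle>) * (of_perm g :: 'a group_algebra)"
    unfolding jucys_murphy_def sum_distrib_left sum_distrib_right
    by (intro sum.cong) (auto simp: swap simp flip: of_perm_mult)
  also have "(\<Sum>j\<in>{1..n}. of_perm \<langle>g \<langle>$\<rangle> j \<leftrightarrow> Suc n\<rangle>) = (\<Sum>j\<in>{1..n}. of_perm \<langle>j \<leftrightarrow> Suc n\<rangle> :: 'a group_algebra)"
    by (rule sum.reindex_bij_betw[OF permutes_imp_bij[OF Sym_apply_permutes[OF g]],
          where g = "\<lambda>j. of_perm \<langle>j \<leftrightarrow> Suc n\<rangle>"])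
  also have "\<dots> = jucys_murphy (Suc n)"
    by (simp add: jucys_murphy_def atLeastLessThanSuc_atLeastAtMost)
  finally show "of_perm g * jucys_murphy (Suc n) = jucys_murphy (Suc n) * (of_perm g :: 'a group_algebra)" .
qed

lemma commute_mult_right:
  fixes x y z :: "'a::semigroup_mult"
  assumes "x * y = y * x" "x * z = z * x"
  shows "x * (y * z) = y * z * x"
  using assms by (metis mult.assoc)

lemma jm_factor_commutes:
  assumes "x * jucys_murphy i = jucys_murphy i * x"
  shows "fps_const x * jm_factor f i = jm_factor f i * fps_const x"
proof (rule fps_ext)
  fix k
  have "x * jucys_murphy i ^ k = jucys_murphy i ^ k * x"
    using power_commuting_commutes[of "jucys_murphy i" x k] assms by simp
  then show "(fps_const x * jm_factor f i) $ k = (jm_factor f i * fps_const x) $ k"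
    by (simp add: jm_factor_nth ga_scale_mult_left ga_scale_mult_right)
qed

text \<open>
  The relations of the degenerate affine Hecke algebra, satisfied by \<open>s = (n n+1)\<close>, \<open>u = J\<^sub>n\<close> and
  \<open>v = J\<^sub>n\<^sub>+\<^sub>1\<close>. With them, moving \<open>s\<close> past a power of \<open>u\<close> turns \<open>u\<close> into \<open>v\<close> and conversely, up to
  the divided difference \<open>h\<close> of the powers. As \<open>h\<close> appears with opposite signs and commutes with
  \<open>v\<close>, the errors cancel in a product of a series in \<open>u\<close> and the same series in \<open>v\<close>.
\<close>

lemma divided_difference:
  fixes s u v :: "'a::ring_1"
  assumes su: "s * u = v * s - 1" and sv: "s * v = u * s + 1" and uv: "u * v = v * u"
  shows "\<exists>h. s * u ^ k = v ^ k * s - h \<and> s * v ^ k = u ^ k * s + h \<and> h * v = v * h \<and>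
    h * (v - u) = v ^ k - u ^ k"
proof (induction k)
  case 0
  show ?case by (intro exI[of _ 0]) simp
next
  case (Suc k)
  then obtain h where h: "s * u ^ k = v ^ k * s - h" "s * v ^ k = u ^ k * s + h" "h * v = v * h"
    "h * (v - u) = v ^ k - u ^ k" by blast
  \<comment> \<open>the last conjunct is the invariant that makes the two recursions for the divided difference agree\<close>
  define h' where "h' = v ^ k + h * u"
  have h'_alt: "h' = u ^ k + h * v"
    using h(4) by (simp add: h'_def algebra_simps)
  have "s * u ^ Suc k = (v ^ k * s - h) * u"
    by (simp only: power_Suc2 mult.assoc[symmetric] h(1))
  also have "\<dots> = v ^ k * (v * s - 1) - h * u"
    by (simp add: left_diff_distrib mult.assoc su)
  also have "\<dots> = v ^ Suc k * s - h'"
    by (simp add: h'_def power_Suc2 algebra_simps del: power_Suc)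
  finally have 1: "s * u ^ Suc k = v ^ Suc k * s - h'" .
  have "s * v ^ Suc k = (u ^ k * s + h) * v"
    by (simp only: power_Suc2 mult.assoc[symmetric] h(2))
  also have "\<dots> = u ^ k * (u * s + 1) + h * v"
    by (simp add: distrib_right mult.assoc sv)
  also have "\<dots> = u ^ Suc k * s + h'"
    by (simp add: h'_alt power_Suc2 algebra_simps del: power_Suc)
  finally have 2: "s * v ^ Suc k = u ^ Suc k * s + h'" .
  have "h * u * v = v * (h * u)"
    by (metis h(3) mult.assoc uv)
  then have 3: "h' * v = v * h'"
    by (simp add: h'_def distrib_left distrib_right power_commutes)
  have "h' * (v - u) = v ^ k * (v - u) + h * (v - u) * u"
    by (simp add: h'_def algebra_simps uv)
  also have "\<dots> = v ^ Suc k - u ^ Suc k"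
    unfolding h(4) by (simp add: power_Suc2 algebra_simps del: power_Suc)
  finally show ?case using 1 2 3 by blast
qed

lemma jm_factors_commute: "jm_factor f (Suc n) * jm_factor f n = jm_factor f n * jm_factor f (Suc n)"
proof (rule fps_mult_commute_coeffs)
  fix i j
  have "jm_factor f n $ j \<in> Sym_algebra n"
    unfolding jm_factor_nth by (intro Sym_algebra_scale Sym_algebra_power jucys_murphy_in) simp
  from commutes_with_Sym_algebra[OF jucys_murphy_commutes this]
  have "jucys_murphy (Suc n) ^ i * jm_factor f n $ j = jm_factor f n $ j * jucys_murphy (Suc n) ^ i"
    by (intro power_commuting_commutes) simp
  then show "jm_factor f (Suc n) $ i * jm_factor f n $ j = jm_factor f n $ j * jm_factor f (Suc n) $ i"
    by (simp add: jm_factor_nth[of _ "Suc n"] ga_scale_mult_left ga_scale_mult_right)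
qed

lemma adjacent_swap_commutes:
  fixes f :: "'a::field fps"
  assumes n: "n \<ge> 1"
  defines "s \<equiv> fps_const (of_perm \<langle>n \<leftrightarrow> Suc n\<rangle>)"
  shows "s * (jm_factor f n * jm_factor f (Suc n)) = jm_factor f n * jm_factor f (Suc n) * s"
proof -
  let ?s = "of_perm \<langle>n \<leftrightarrow> Suc n\<rangle> :: 'a group_algebra"
  let ?u = "jucys_murphy n :: 'a group_algebra" and ?v = "jucys_murphy (Suc n) :: 'a group_algebra"
  have ss: "?s * ?s = 1" by (simp flip: of_perm_mult)
  have "\<langle>n \<leftrightarrow> Suc n\<rangle> * \<langle>j \<leftrightarrow> n\<rangle> = \<langle>j \<leftrightarrow> Suc n\<rangle> * \<langle>n \<leftrightarrow> Suc n\<rangle>" if "j \<in> {1..<n}" for j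
    using swap_conj[of "\<langle>n \<leftrightarrow> Suc n\<rangle>" j n] that by simp
  then have "?s * ?u = (\<Sum>j\<in>{1..<n}. of_perm \<langle>j \<leftrightarrow> Suc n\<rangle>) * ?s"
    unfolding jucys_murphy_def sum_distrib_left sum_distrib_right
    by (intro sum.cong refl) (simp flip: of_perm_mult)
  moreover have "?v = (\<Sum>j\<in>{1..<n}. of_perm \<langle>j \<leftrightarrow> Suc n\<rangle>) + ?s"
    unfolding jucys_murphy_def using n by simp
  ultimately have su: "?s * ?u = ?v * ?s - 1"
    by (simp add: distrib_right ss)
  have "?u * ?s = ?s * (?s * ?u) * ?s"
    by (simp add: ss flip: mult.assoc)
  also have "\<dots> = ?s * ?v * (?s * ?s) - ?s * ?s"
    unfolding su by (simp add: algebra_simps)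
  finally have sv: "?s * ?v = ?u * ?s + 1" by (simp add: ss)
  have uv: "?u * ?v = ?v * ?u"
    by (rule commutes_with_Sym_algebra[OF jucys_murphy_commutes jucys_murphy_in]) simp
  obtain h where h: "\<And>k. ?s * ?u ^ k = ?v ^ k * ?s - h k" "\<And>k. ?s * ?v ^ k = ?u ^ k * ?s + h k"
    "\<And>k. h k * ?v = ?v * h k"
    using divided_difference[OF su sv uv] by metis
  define U where "U = jm_factor f n"
  define V where "V = jm_factor f (Suc n)"
  define H where "H = Abs_fps (\<lambda>k. ga_scale (f $ k) (h k))"
  have UV: "V * U = U * V"
    unfolding U_def V_def by (rule jm_factors_commute)
  have HV: "H * V = V * H"
  proof (rule fps_mult_commute_coeffs)
    fix i j
    have "h i * ?v ^ j = ?v ^ j * h i"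
      using power_commuting_commutes[of ?v "h i" j] h(3) by simp
    then show "H $ i * V $ j = V $ j * H $ i"
      by (simp add: H_def V_def jm_factor_nth ga_scale_mult_left ga_scale_mult_right)
  qed
  have sU: "s * U = V * s - H"
    by (rule fps_ext)
       (simp add: s_def U_def V_def H_def jm_factor_nth ga_scale_mult_left ga_scale_mult_right h(1)
         ga.scale_right_diff_distrib)
  have sV: "s * V = U * s + H"
    by (rule fps_ext)
       (simp add: s_def U_def V_def H_def jm_factor_nth ga_scale_mult_left ga_scale_mult_right h(2)
         ga.scale_right_distrib)
  have "s * (U * V) = (V * s - H) * V"
    by (simp only: sU flip: mult.assoc)
  also have "\<dots> = V * (U * s + H) - H * V"
    by (simp only: left_diff_distrib mult.assoc sV)
  also have "\<dots> = U * V * s"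
    by (simp add: distrib_left HV flip: mult.assoc UV)
  finally show ?thesis by (simp add: U_def V_def)
qed

text \<open>
  The product for \<open>n + 1\<close> commutes with the symmetric group on \<open>n\<close> letters and with the last adjacent
  transposition. These generate the symmetric group on \<open>n + 1\<close> letters.
\<close>

lemma jucys_murphy_product_commutes:
  assumes "g \<in> Sym n"
  shows "fps_const (of_perm g) * jucys_murphy_product f n =
    jucys_murphy_product f n * fps_const (of_perm g)"
  using assms
proof (induction n arbitrary: g)
  case 0
  then show ?case by (simp add: jucys_murphy_product_0)
next
  case (Suc n)
  let ?P = "jucys_murphy_product f (Suc n)"
  let ?c = "\<lambda>g. fps_const (of_perm g) :: 'a group_algebra fps"
  have mult: "?c (g * h) * ?P = ?P * ?c (g * h)"
    if "?c g * ?P = ?P * ?c g" "?c h * ?P = ?P * ?c h" for g h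
  proof -
    have "?c (g * h) = ?c g * ?c h" by (simp add: of_perm_mult)
    then show ?thesis
      using commute_mult_right[of ?P "?c g" "?c h"] that by simp
  qed
  have lower: "?c g * ?P = ?P * ?c g" if "g \<in> Sym n" for g
  proof -
    have "?c g * jm_factor f (Suc n) = jm_factor f (Suc n) * ?c g"
      using jucys_murphy_commutes[of n, where 'a = 'a] that
      by (intro jm_factor_commutes) (simp add: commutes_with_Sym_def)
    then show ?thesis
      unfolding jucys_murphy_product_Suc by (rule commute_mult_right[OF Suc.IH[OF that]])
  qed
  have adjacent: "?c \<langle>n \<leftrightarrow> Suc n\<rangle> * ?P = ?P * ?c \<langle>n \<leftrightarrow> Suc n\<rangle>" if "n \<ge> 1"
  proof -
    from that obtain k where k: "n = Suc k" by (cases n) auto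
    have "?c \<langle>n \<leftrightarrow> Suc n\<rangle> * jucys_murphy_product f k = jucys_murphy_product f k * ?c \<langle>n \<leftrightarrow> Suc n\<rangle>"
    proof (rule fps_ext)
      fix i
      have "of_perm g * of_perm \<langle>n \<leftrightarrow> Suc n\<rangle> = (of_perm \<langle>n \<leftrightarrow> Suc n\<rangle> * of_perm g :: 'a group_algebra)"
        if "g \<in> Sym k" for g
      proof -
        have "Suc k \<notin> affected g" "Suc (Suc k) \<notin> affected g"
          using that by (auto simp: Sym_def)
        then have "g * \<langle>n \<leftrightarrow> Suc n\<rangle> = \<langle>n \<leftrightarrow> Suc n\<rangle> * g"
          by (intro perm_mult_commute) (simp add: affected_swap k)
        then show ?thesis by (simp flip: of_perm_mult)
      qed
      then have "commutes_with_Sym k (of_perm \<langle>n \<leftrightarrow> Suc n\<rangle> :: 'a group_algebra)"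
        by (simp add: commutes_with_Sym_def)
      from commutes_with_Sym_algebra[OF this jucys_murphy_product_in]
      show "(?c \<langle>n \<leftrightarrow> Suc n\<rangle> * jucys_murphy_product f k) $ i =
          (jucys_murphy_product f k * ?c \<langle>n \<leftrightarrow> Suc n\<rangle>) $ i"
        by simp
    qed
    moreover have "?P = jucys_murphy_product f k * (jm_factor f n * jm_factor f (Suc n))"
      by (simp add: jucys_murphy_product_Suc k mult.assoc)
    ultimately show ?thesis
      using commute_mult_right[OF _ adjacent_swap_commutes[OF that, of f]] by simp
  qed
  have swaps: "?c \<langle>j \<leftrightarrow> Suc n\<rangle> * ?P = ?P * ?c \<langle>j \<leftrightarrow> Suc n\<rangle>" if j: "j \<in> {1..n}" for j
  proof (cases "j = n")
    case True
    then show ?thesis using adjacent j by simp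
  next
    case False
    have "\<langle>j \<leftrightarrow> n\<rangle> * \<langle>n \<leftrightarrow> Suc n\<rangle> = \<langle>j \<leftrightarrow> Suc n\<rangle> * \<langle>j \<leftrightarrow> n\<rangle>"
      using swap_conj[of "\<langle>j \<leftrightarrow> n\<rangle>" n "Suc n"] j False by simp
    then have "\<langle>j \<leftrightarrow> Suc n\<rangle> = \<langle>j \<leftrightarrow> n\<rangle> * \<langle>n \<leftrightarrow> Suc n\<rangle> * \<langle>j \<leftrightarrow> n\<rangle>"
      by (simp add: mult.assoc)
    moreover have "\<langle>j \<leftrightarrow> n\<rangle> \<in> Sym n" using j by (intro Sym_swap) auto
    ultimately show ?thesis
      using j by (simp only:) (intro mult lower adjacent, auto)
  qed
  \<comment> \<open>split off the image of the last letter; the remaining factor \<open>h\<close> fixes the last letter\<close>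
  define j where "j = g \<langle>$\<rangle> (Suc n)"
  have j: "j \<in> {1..Suc n}"
    unfolding j_def using Sym_apply_in[OF Suc.prems, of "Suc n"] by simp
  define h where "h = \<langle>j \<leftrightarrow> Suc n\<rangle> * g"
  have "h \<in> Sym (Suc n)" unfolding h_def using j Suc.prems by (intro Sym_mult Sym_swap) auto
  moreover have "h \<langle>$\<rangle> (Suc n) = Suc n" by (simp add: h_def j_def)
  ultimately have "h \<in> Sym n"
    by (auto simp: Sym_def in_affected subset_iff le_Suc_eq)
  have g: "g = \<langle>j \<leftrightarrow> Suc n\<rangle> * h" by (simp add: h_def flip: mult.assoc)
  show ?case
  proof (cases "j = Suc n")
    case True
    then show ?thesis using lower[OF \<open>h \<in> Sym n\<close>] g by simp
  next
    case False
    then have "j \<in> {1..n}" using j by auto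
    then show ?thesis unfolding g by (intro mult swaps lower \<open>h \<in> Sym n\<close>)
  qed
qed

lemma jucys_murphy_product_nth_commutes: "commutes_with_Sym n (jucys_murphy_product f n $ k)"
  unfolding commutes_with_Sym_def
proof
  fix g assume "g \<in> Sym n"
  from jucys_murphy_product_commutes[OF this, of f]
  show "of_perm g * jucys_murphy_product f n $ k = jucys_murphy_product f n $ k * of_perm g"
    by (metis fps_mult_left_const_nth fps_mult_right_const_nth)
qed


section \<open>The eigenvalue of the product on an irreducible module\<close>

lemma ga_fps_lift_nth [simp]: "ga_fps_lift f $ k = ga_const (f $ k)"
  by (simp add: ga_fps_lift_def)

lemma ga_const_sum: "ga_const (\<Sum>i\<in>I. c i) = (\<Sum>i\<in>I. ga_const (c i))"
  by (induction I rule: infinite_finite_induct) (simp_all add: ga_const_simps)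

lemma ga_fps_lift_mult: "ga_fps_lift (f * g) = ga_fps_lift f * ga_fps_lift g"
  by (rule fps_ext) (simp add: fps_mult_nth ga_const_sum ga_const_simps)

lemma ga_fps_lift_one: "ga_fps_lift 1 = 1"
  by (rule fps_ext) (simp add: ga_const_simps)

lemma ga_fps_lift_commute: "ga_fps_lift f * x = x * ga_fps_lift f"
  by (rule fps_mult_commute_coeffs) (simp add: ga_const_commute)

lemma jucys_murphy_product_mult_young_symmetrizer:
  fixes f :: "'a::field_char_0 fps"
  assumes \<mu>: "\<mu> \<in> partitions_of n"
  shows "jucys_murphy_product f n $ k * young_symmetrizer \<mu> =
    ga_scale ((\<Prod>c\<in>cells \<mu>. f oo (fps_const (of_int (content c)) * fps_X)) $ k) (young_symmetrizer \<mu>)"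
proof -
  let ?e = "fps_const (young_symmetrizer \<mu>) :: 'a group_algebra fps"
  let ?\<phi> = "\<lambda>c. f oo (fps_const (of_int (content c)) * fps_X)"
  let ?c = "\<lambda>m. (row_of \<mu> m, col_of \<mu> m)"
  define \<psi> where "\<psi> m = ?\<phi> (?c m)" for m
  have factor: "jm_factor f m * ?e = ga_fps_lift (\<psi> m) * ?e" if m: "m \<in> {1..n}" for m
  proof (rule fps_ext)
    fix k
    have "jucys_murphy m ^ k * young_symmetrizer \<mu> =
        ga_scale (of_int (content (?c m)) ^ k) (young_symmetrizer \<mu> :: 'a group_algebra)"
    proof (induction k)
      case (Suc k)
      then show ?case
        by (simp add: mult.assoc ga_scale_mult_right mult.commute
            jucys_murphy_mult_young_symmetrizer[OF \<mu> m] del: power_Suc add: power_Suc2)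
    qed simp
    then show "(jm_factor f m * ?e) $ k = (ga_fps_lift (\<psi> m) * ?e) $ k"
      by (simp add: jm_factor_nth ga_scale_mult_left fps_compose_linear_nth \<psi>_def flip: ga_scale_def)
  qed
  have "prod_list (map (jm_factor f) ms) * ?e = ga_fps_lift (prod_list (map \<psi> ms)) * ?e"
    if "set ms \<subseteq> {1..n}" for ms
    using that
  proof (induction ms)
    case Nil
    show ?case by (simp add: ga_fps_lift_one)
  next
    case (Cons m ms)
    let ?L = "ga_fps_lift (prod_list (map \<psi> ms))"
    have "prod_list (map (jm_factor f) (m # ms)) * ?e = jm_factor f m * (?L * ?e)"
      using Cons by (simp add: mult.assoc)
    also have "\<dots> = ?L * (jm_factor f m * ?e)"
      by (metis ga_fps_lift_commute mult.assoc)
    also have "\<dots> = ?L * ga_fps_lift (\<psi> m) * ?e"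
      using factor[of m] Cons.prems by (simp add: mult.assoc)
    also have "?L * ga_fps_lift (\<psi> m) = ga_fps_lift (prod_list (map \<psi> (m # ms)))"
      by (simp add: ga_fps_lift_mult ga_fps_lift_commute[of "\<psi> m"])
    finally show ?case .
  qed
  from this[of "[1..<Suc n]"]
  have "jucys_murphy_product f n * ?e = ga_fps_lift (prod_list (map \<psi> [1..<Suc n])) * ?e"
    by (simp add: jucys_murphy_product_def jm_factor_def[abs_def] atLeastLessThanSuc_atLeastAtMost
        del: upt_Suc)
  also have "prod_list (map \<psi> [1..<Suc n]) = (\<Prod>m\<in>{1..n}. \<psi> m)"
    by (subst prod.distinct_set_conv_list[symmetric])
       (simp_all add: atLeastLessThanSuc_atLeastAtMost del: upt_Suc)
  also have "\<dots> = (\<Prod>c\<in>cells \<mu>. ?\<phi> c)"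
    by (subst prod.reindex_bij_betw[OF bij_betw_tableau_partition[OF \<mu>], symmetric])
       (auto intro!: prod.cong simp: \<psi>_def)
  finally have "(jucys_murphy_product f n * ?e) $ k = (ga_fps_lift (\<Prod>c\<in>cells \<mu>. ?\<phi> c) * ?e) $ k"
    by simp
  then show ?thesis by (simp add: ga_scale_def)
qed


section \<open>The content series\<close>

lemma mps_coeff_const_mult: "mps_coeff (mps_const c * F) m = c * mps_coeff F m"
proof (transfer)
  fix c :: 'a and F :: "(nat \<Rightarrow>\<^sub>0 nat) \<Rightarrow> 'a" and m
  have "(\<Sum>(a, b) | a + b = m. (if a = 0 then c else 0) * F b) =
      (\<Sum>(a, b) \<in> {(0 :: nat \<Rightarrow>\<^sub>0 nat, m)}. (if a = 0 then c else 0) * F b)"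
    by (rule sum.mono_neutral_right) (auto simp: finite_monomial_factors split: if_splits)
  then show "(\<Sum>(a, b) | a + b = m. (if a = 0 then c else 0) * F b) = c * F m"
    by simp
qed

lemma mps_coeff_mult_const: "mps_coeff (F * mps_const c) m = c * mps_coeff F m"
  by (simp add: mult.commute[of F] mps_coeff_const_mult)

lemma mps_coeff_add: "mps_coeff (F + G) m = mps_coeff F m + mps_coeff G m"
  by transfer simp

lemma mps_coeff_zero: "mps_coeff 0 m = 0"
  by transfer simp

lemma mps_coeff_sum: "mps_coeff (\<Sum>i\<in>I. F i) m = (\<Sum>i\<in>I. mps_coeff (F i) m)"
  by (induction I rule: infinite_finite_induct) (simp_all add: mps_coeff_add mps_coeff_zero)

lemma character_value_one: "character_value \<mu> (replicate (sum_list \<mu>) 1) = irreducible_character \<mu> 1"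
  by (simp add: character_value_def conj_class_replicate_one del: replicate.simps One_nat_def)

text \<open>
  Frobenius' formula for the coefficient of \<open>y\<^sup>k\<close> in the product of series in Jucys--Murphy elements.
  With \<open>h = young_norm \<mu>\<close>, the coordinate contributes \<open>1 / h\<^sup>2\<close> and the central symmetrizer \<open>h\<close>
  times the character, which leaves \<open>1 / h\<close>, that is, the dimension divided by \<open>n!\<close>.
\<close>

lemma class_coeff_jucys_murphy_product:
  fixes f :: "'a::field_char_0 fps"
  assumes \<alpha>: "\<alpha> \<in> partitions_of n"
  shows "class_coeff n \<alpha> (jucys_murphy_product f n $ k) =
    (\<Sum>\<mu>\<in>partitions_of n. character_value \<mu> (replicate n 1) * character_value \<mu> \<alpha> / fact n *
      (\<Prod>c\<in>cells \<mu>. f oo (fps_const (of_int (content c)) * fps_X)) $ k)"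
proof -
  let ?B = "jucys_murphy_product f n $ k"
  let ?\<omega> = "\<lambda>\<mu>. (\<Prod>c\<in>cells \<mu>. f oo (fps_const (of_int (content c)) * fps_X)) $ k"
  define g where "g = (SOME g. g \<in> conj_class n \<alpha>)"
  have g: "g \<in> conj_class n \<alpha>"
    using conj_class_nonempty[OF \<alpha>] unfolding g_def by (simp add: some_in_eq)
  then have gS: "g \<in> Sym n" by (simp add: conj_class_def)
  \<comment> \<open>the inverse, in the same class, because the character at \<open>g\<close> is the coefficient of \<open>inverse g\<close>\<close>
  have "class_coeff n \<alpha> ?B = ga_coeff ?B (inverse g)"
    by (rule class_coeff_eq_ga_coeff[OF central_in_span_class_sums[OF jucys_murphy_product_in
          jucys_murphy_product_nth_commutes] \<alpha> conj_class_inverse[OF g]])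
  also have "\<dots> = ga_coeff (\<Sum>\<mu>\<in>partitions_of n.
      ga_scale (?\<omega> \<mu> / (young_norm \<mu>)\<^sup>2) (central_symmetrizer \<mu>)) (inverse g)"
    by (rule arg_cong[OF central_expansion[OF jucys_murphy_product_in
          jucys_murphy_product_nth_commutes jucys_murphy_product_mult_young_symmetrizer]])
  also have "\<dots> =
      (\<Sum>\<mu>\<in>partitions_of n. ?\<omega> \<mu> / (young_norm \<mu>)\<^sup>2 * ga_coeff (central_symmetrizer \<mu>) (inverse g))"
    by (simp add: lookup_sum)
  also have "\<dots> = (\<Sum>\<mu>\<in>partitions_of n. character_value \<mu> (replicate n 1) * character_value \<mu> \<alpha> / fact n * ?\<omega> \<mu>)"
  proof (rule sum.cong[OF refl])
    fix \<mu> assume \<mu>: "\<mu> \<in> partitions_of n"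
    note n = partitions_ofD(3)[OF \<mu>]
    have "character_value \<mu> (replicate n 1) = (irreducible_character \<mu> 1 :: 'a)"
      using character_value_one[of \<mu>] by (simp add: n)
    then have dim: "character_value \<mu> (replicate n 1) = fact n / (young_norm \<mu> :: 'a)"
      using young_norm_mult_dimension[OF \<mu>, where 'a = 'a] young_norm_nonzero[OF \<mu>, where 'a = 'a]
      by (simp add: field_simps)
    have "character_value \<mu> \<alpha> = (irreducible_character \<mu> g :: 'a)"
      by (simp add: character_value_def n g_def)
    then have char: "ga_coeff (central_symmetrizer \<mu>) (inverse g) = young_norm \<mu> * (character_value \<mu> \<alpha> :: 'a)"
      using young_norm_mult_character[OF \<mu> gS, where 'a = 'a] by simp
    show "?\<omega> \<mu> / (young_norm \<mu>)\<^sup>2 * ga_coeff (central_symmetrizer \<mu>) (inverse g) =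
        character_value \<mu> (replicate n 1) * character_value \<mu> \<alpha> / fact n * ?\<omega> \<mu>"
      unfolding dim char using young_norm_nonzero[OF \<mu>, where 'a = 'a]
      by (simp add: field_simps power2_eq_square)
  qed
  finally show ?thesis .
qed

theorem proposition3p1:
  fixes f :: "'a::field_char_0 fps"
  shows "content_series f =
    Abs_fps (\<lambda>n. fps_const (mps_const (1 / fact n)) *
      (\<Sum>\<alpha>\<in>partitions_of n.
         fps_const (power_sums \<alpha> * mps_const (of_nat (card (conj_class n \<alpha>)))) *
         fps_lift (fps_class_coeff n \<alpha> (jucys_murphy_product f n))))"
  unfolding content_series_def
proof (rule arg_cong[of _ _ Abs_fps], rule ext, rule arg_cong[of _ _ "(*) _"], rule fps_ext, rule mps_eqI)
  fix n k m
  let ?\<omega> = "\<lambda>\<mu>. (\<Prod>c\<in>cells \<mu>. f oo (fps_const (of_int (content c)) * fps_X)) $ k"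
  let ?p = "\<lambda>\<alpha>. mps_coeff (power_sums \<alpha> :: 'a mps) m" and ?N = "\<lambda>\<alpha>. of_nat (card (conj_class n \<alpha>)) :: 'a"
  let ?\<chi> = "character_value :: nat list \<Rightarrow> nat list \<Rightarrow> 'a"
  let ?lhs = "(\<Sum>\<mu>\<in>partitions_of n.
        fps_const (mps_const (character_value \<mu> (replicate n 1)) * schur \<mu>) *
        fps_lift (\<Prod>c\<in>cells \<mu>. f oo (fps_const (of_int (content c)) * fps_X)))"
  let ?rhs = "(\<Sum>\<alpha>\<in>partitions_of n.
        fps_const (power_sums \<alpha> * mps_const (of_nat (card (conj_class n \<alpha>)))) *
        fps_lift (fps_class_coeff n \<alpha> (jucys_murphy_product f n)))"
  have schur: "mps_coeff (schur \<mu>) m = (\<Sum>\<alpha>\<in>partitions_of n. ?N \<alpha> / fact n * ?\<chi> \<mu> \<alpha> * ?p \<alpha>)"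
    if "\<mu> \<in> partitions_of n" for \<mu>
    by (simp add: schur_def Let_def partitions_ofD(3)[OF that] mps_coeff_sum mps_coeff_const_mult)
  have "mps_coeff (?lhs $ k) m =
      (\<Sum>\<mu>\<in>partitions_of n. ?\<omega> \<mu> * (?\<chi> \<mu> (replicate n 1) * mps_coeff (schur \<mu>) m))"
    by (simp add: fps_sum_nth mps_coeff_sum fps_lift_def mps_coeff_mult_const
        mps_coeff_const_mult)
  also have "\<dots> = (\<Sum>\<mu>\<in>partitions_of n. \<Sum>\<alpha>\<in>partitions_of n.
      ?N \<alpha> * ?p \<alpha> * (?\<chi> \<mu> (replicate n 1) * ?\<chi> \<mu> \<alpha> / fact n * ?\<omega> \<mu>))"
    by (intro sum.cong refl) (simp add: schur sum_distrib_left mult_ac)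
  also have "\<dots> = (\<Sum>\<alpha>\<in>partitions_of n. \<Sum>\<mu>\<in>partitions_of n.
      ?N \<alpha> * ?p \<alpha> * (?\<chi> \<mu> (replicate n 1) * ?\<chi> \<mu> \<alpha> / fact n * ?\<omega> \<mu>))"
    by (rule sum.swap)
  also have "\<dots> = (\<Sum>\<alpha>\<in>partitions_of n. ?N \<alpha> * ?p \<alpha> * class_coeff n \<alpha> (jucys_murphy_product f n $ k))"
    by (intro sum.cong refl) (simp add: class_coeff_jucys_murphy_product sum_distrib_left)
  also have "\<dots> = mps_coeff (?rhs $ k) m"
    by (simp add: fps_sum_nth mps_coeff_sum fps_lift_def fps_class_coeff_def mps_coeff_mult_const)
       (simp add: mult_ac)
  finally show "mps_coeff (?lhs $ k) m = mps_coeff (?rhs $ k) m" .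
qed

end
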